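(* There exists a universal constant $C_0>0$ such that the following holds. Let $\{\mathbf A_n\}_{n\ge1}$ be a sequence of real symmetric $n\times n$ matrices with $\sup_n\|\mathbf A_n\|<\infty$ (operator norm), $\mathrm{Tr}(\mathbf A_n^2)=o(n)$ and $\limsup_{n\to\infty}\|\mathbf A_n\|\le C_0$. Let $\widehat{\mathrm{DE}}_M$ and $\widehat{\mathrm{IE}}_M$ be the estimators produced after $M$ iterations by the mean-field algorithm described in the context, and let $\mathrm{DE}$, $\mathrm{IE}$ be the direct and indirect effects defined in the context. Then $$\lim_{M\to\infty}\lim_{n\to\infty}\big|\mathbb E(\widehat{\mathrm{DE}}_M)-\mathrm{DE}\big|=0,\qquad \lim_{M\to\infty}\lim_{n\to\infty}\big|\mathbb E(\widehat{\mathrm{IE}}_M)-\mathrm{IE}\big|=0,$$ where $\mathbb E[\cdot]$ denotes expectation with respect to $(\bar{\mathbf T},\bar{\mathbf X})$.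
   Context: Setting. $\mu$ is a probability measure supported on $[-1,1]$ with at least two points in its support. The dimension $d$ is fixed; the parameters satisfy $(\tau_0,\boldsymbol\theta_0)\in[-B,B]\times[-M_0,M_0]^d$ for some $B,M_0>0$. For $\mathbf t\in\{\pm1\}^n$ and $\mathbf x\in[-1,1]^{n\times d}$ with rows $\mathbf x_i^\top$, let $f(\cdot|\mathbf t,\mathbf x)$ be the probability measure on $[-1,1]^n$ given by $$f(\mathbf y|\mathbf t,\mathbf x)=\frac1{Z_n(\mathbf t,\mathbf x)}\exp\Big(\tfrac12\mathbf y^\top\mathbf A_n\mathbf y+\mathbf y^\top(\tau_0\mathbf t+\mathbf x\boldsymbol\theta_0)\Big)\prod_{i=1}^n d\mu(y_i),$$ with $Z_n(\mathbf t,\mathbf x)$ the normalizing constant. Write $\langle\mathbf Y_i\rangle_{\mathbf t,\mathbf x}$ for the mean of the $i$-th coordinate under $f(\cdot|\mathbf t,\mathbf x)$. $\mathbb P_X$ is a probability distribution on $[-1,1]^d$ whose covariance matrix has all eigenvalues in $[c,C]$ for some $0<c\le C<\infty$. Causal estimands. Let $\bar{\mathbf X}$ have i.i.d. rows $\bar{\mathbf X}_i\sim\mathbb P_X$. For $\mathbf t_{-i}\in\{\pm1\}^{n-1}$, let $(c,\mathbf t_{-i})$ denote the vector with $i$-th entry $c$ and remaining entries $\mathbf t_{-i}$. Define $$\mathrm{DE}=\frac1n\sum_{i=1}^n\sum_{\mathbf t_{-i}}2^{-(n-1)}\,\mathbb E_{\bar{\mathbf X}}\big[\langle\mathbf Y_i\rangle_{(1,\mathbf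 t_{-i}),\bar{\mathbf X}}-\langle\mathbf Y_i\rangle_{(-1,\mathbf t_{-i}),\bar{\mathbf X}}\big],$$ $$\mathrm{IE}=\frac1n\sum_{i=1}^n\sum_{\mathbf t_{-i}}2^{-(n-1)}\,\mathbb E_{\bar{\mathbf X}}\big[\langle\mathbf Y_i\rangle_{(-1,\mathbf t_{-i}),\bar{\mathbf X}}-\langle\mathbf Y_i\rangle_{-\mathbf 1,\bar{\mathbf X}}\big].$$ Function $\alpha$. For $\lambda_1\in\mathbb R$, $\lambda_2\ge0$, $\alpha(\lambda_1,\lambda_2)=\log\int e^{\lambda_1x+\frac{\lambda_2}2x^2}d\mu(x)$; $\alpha'$ and $\alpha''$ denote the first and second derivatives in the first argument. $\alpha'$ is applied coordinatewise to vectors. Mean-field algorithm. (i) Draw $\bar{\mathbf T}\sim\mathrm{Unif}(\{\pm1\}^n)$ and, independently, $\bar{\mathbf X}$ with i.i.d. rows from $\mathbb P_X$. (ii) Set $\mathbf u^{(0)}=\mathbf 0$ and $\mathbf u^{(\ell+1)}=\alpha'(\mathbf A_n\mathbf u^{(\ell)}+\tau_0\bar{\mathbf T}+\bar{\mathbf X}\boldsymbol\theta_0,0)$. (iii) Set $\tilde{\mathbf u}^{(0)}=\mathbf 0$ and $\tilde{\mathbf u}^{(\ell+1)}=\alpha'(\mathbf A_n\tilde{\mathbf u}^{(\ell)}-\tau_0\mathbf 1+\bar{\mathbf X}\boldsymbol\theta_0,0)$. (iv) $\widehat{\mathrm{DE}}_M=\frac2n\sum_{i=1}^n\bar T_iu_i^{(M)}$.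 (v) $\widehat{\mathrm{IE}}_M=\frac1n\big(\sum_{i=1}^nu_i^{(M)}-\sum_{i=1}^n\tilde u_i^{(M)}\big)-\frac12\widehat{\mathrm{DE}}_M$.
   Formalization: The inner limit in n is taken as a limsup, since for fixed M it need not exist (e.g. A_n = 0 for odd n, (β/n)11ᵀ for even n); wherever the inner limit exists the two coincide. *)

theory Defs
  imports
    "HOL-Probability.Probability"
    "HOL-Library.Landau_Symbols"
    "Jordan_Normal_Form.Char_Poly"
begin

text \<open>
  Dimensions vary inside the statement, so a vector in \<open>\<real>\<^sup>n\<close> is a function \<open>nat \<Rightarrow> real\<close> of
  which only the values on \<open>{..<n}\<close> matter, with coordinates numbered from 0. The rows of the
  covariate matrix \<open>x\<close> are \<open>x 0, \<dots>, x (n - 1)\<close>, each a vector in \<open>\<real>\<^sup>d\<close>. Matrices are those of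
  Jordan_Normal_Form.
\<close>

definition mat_apply :: "real mat \<Rightarrow> (nat \<Rightarrow> real) \<Rightarrow> nat \<Rightarrow> real" where
  "mat_apply A u i = (\<Sum>j<dim_col A. A $$ (i, j) * u j)"

definition op_norm :: "real mat \<Rightarrow> real" where
  "op_norm A =
    (SUP u\<in>{u. L2_set u {..<dim_col A} \<le> 1}. L2_set (mat_apply A u) {..<dim_row A})"

definition mat_trace :: "real mat \<Rightarrow> real" where
  "mat_trace A = (\<Sum>i<dim_row A. A $$ (i, i))"

definition measure_support :: "'a::topological_space measure \<Rightarrow> 'a set" where
  "measure_support \<mu> = {x. \<forall>U. open U \<longrightarrow> x \<in> U \<longrightarrow> emeasure \<mu> U > 0}"

definition covariance_mat :: "nat \<Rightarrow> (nat \<Rightarrow> real) measure \<Rightarrow> real mat" where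
  "covariance_mat d P = Matrix.mat d d (\<lambda>(j, k).
     \<integral>x. (x j - (\<integral>z. z j \<partial>P)) * (x k - (\<integral>z. z k \<partial>P)) \<partial>P)"

definition sign_vectors :: "nat set \<Rightarrow> (nat \<Rightarrow> real) set" where
  "sign_vectors I = (\<Pi>\<^sub>E i\<in>I. {-1, 1})"

definition iid_rows :: "nat \<Rightarrow> (nat \<Rightarrow> real) measure \<Rightarrow> (nat \<Rightarrow> nat \<Rightarrow> real) measure" where
  "iid_rows n P = (\<Pi>\<^sub>M i\<in>{..<n}. P)"

definition ext_field ::
    "nat \<Rightarrow> real \<Rightarrow> (nat \<Rightarrow> real) \<Rightarrow> (nat \<Rightarrow> real) \<Rightarrow> (nat \<Rightarrow> nat \<Rightarrow> real) \<Rightarrow> nat \<Rightarrow> real" where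
  "ext_field d \<tau> \<theta> t x i = \<tau> * t i + (\<Sum>k<d. x i k * \<theta> k)"

text \<open>
  The Gibbs measure with external field \<open>h\<close>; the measure \<open>f(\<cdot>|t,x)\<close> is obtained for
  \<open>h = ext_field d \<tau> \<theta> t x\<close>.
\<close>

definition gibbs_weight :: "nat \<Rightarrow> real mat \<Rightarrow> (nat \<Rightarrow> real) \<Rightarrow> (nat \<Rightarrow> real) \<Rightarrow> real" where
  "gibbs_weight n A h y = exp (1/2 * (\<Sum>i<n. y i * mat_apply A y i) + (\<Sum>i<n. y i * h i))"

definition gibbs_Z :: "nat \<Rightarrow> real mat \<Rightarrow> real measure \<Rightarrow> (nat \<Rightarrow> real) \<Rightarrow> real" where
  "gibbs_Z n A \<mu> h = (\<integral>y. gibbs_weight n A h y \<partial>(\<Pi>\<^sub>M i\<in>{..<n}. \<mu>))"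

definition gibbs :: "nat \<Rightarrow> real mat \<Rightarrow> real measure \<Rightarrow> (nat \<Rightarrow> real) \<Rightarrow> (nat \<Rightarrow> real) measure" where
  "gibbs n A \<mu> h =
    density (\<Pi>\<^sub>M i\<in>{..<n}. \<mu>) (\<lambda>y. ennreal (gibbs_weight n A h y / gibbs_Z n A \<mu> h))"

definition gibbs_mean :: "nat \<Rightarrow> real mat \<Rightarrow> real measure \<Rightarrow> (nat \<Rightarrow> real) \<Rightarrow> nat \<Rightarrow> real" where
  "gibbs_mean n A \<mu> h i = (\<integral>y. y i \<partial>(gibbs n A \<mu> h))"

definition direct_effect :: "nat \<Rightarrow> real mat \<Rightarrow> real measure \<Rightarrow> nat \<Rightarrow> real \<Rightarrow> (nat \<Rightarrow> real) \<Rightarrow>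
    (nat \<Rightarrow> real) measure \<Rightarrow> real" where
  "direct_effect n A \<mu> d \<tau> \<theta> P =
    1 / real n * (\<Sum>i<n. \<Sum>t\<in>sign_vectors ({..<n} - {i}). (1/2) ^ (n - 1) *
      (\<integral>x. gibbs_mean n A \<mu> (ext_field d \<tau> \<theta> (t(i := 1)) x) i
           - gibbs_mean n A \<mu> (ext_field d \<tau> \<theta> (t(i := -1)) x) i \<partial>(iid_rows n P)))"

definition indirect_effect :: "nat \<Rightarrow> real mat \<Rightarrow> real measure \<Rightarrow> nat \<Rightarrow> real \<Rightarrow> (nat \<Rightarrow> real) \<Rightarrow>
    (nat \<Rightarrow> real) measure \<Rightarrow> real" where
  "indirect_effect n A \<mu> d \<tau> \<theta> P =
    1 / real n * (\<Sum>i<n. \<Sum>t\<in>sign_vectors ({..<n} - {i}). (1/2) ^ (n - 1) *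
      (\<integral>x. gibbs_mean n A \<mu> (ext_field d \<tau> \<theta> (t(i := -1)) x) i
           - gibbs_mean n A \<mu> (ext_field d \<tau> \<theta> (\<lambda>_. -1) x) i \<partial>(iid_rows n P)))"

definition alpha :: "real measure \<Rightarrow> real \<Rightarrow> real \<Rightarrow> real" where
  "alpha \<mu> l1 l2 = ln (\<integral>x. exp (l1 * x + l2 / 2 * x\<^sup>2) \<partial>\<mu>)"

definition alpha' :: "real measure \<Rightarrow> real \<Rightarrow> real \<Rightarrow> real" where
  "alpha' \<mu> l1 l2 = deriv (\<lambda>l. alpha \<mu> l l2) l1"

primrec mf_iter :: "real mat \<Rightarrow> real measure \<Rightarrow> (nat \<Rightarrow> real) \<Rightarrow> nat \<Rightarrow> nat \<Rightarrow> real" where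
  "mf_iter A \<mu> h 0 = (\<lambda>i. 0)"
| "mf_iter A \<mu> h (Suc l) = (\<lambda>i. alpha' \<mu> (mat_apply A (mf_iter A \<mu> h l) i + h i) 0)"

definition DE_hat :: "nat \<Rightarrow> real mat \<Rightarrow> real measure \<Rightarrow> nat \<Rightarrow> real \<Rightarrow> (nat \<Rightarrow> real) \<Rightarrow> nat \<Rightarrow>
    (nat \<Rightarrow> real) \<Rightarrow> (nat \<Rightarrow> nat \<Rightarrow> real) \<Rightarrow> real" where
  "DE_hat n A \<mu> d \<tau> \<theta> M t x =
    2 / real n * (\<Sum>i<n. t i * mf_iter A \<mu> (ext_field d \<tau> \<theta> t x) M i)"

definition IE_hat :: "nat \<Rightarrow> real mat \<Rightarrow> real measure \<Rightarrow> nat \<Rightarrow> real \<Rightarrow> (nat \<Rightarrow> real) \<Rightarrow> nat \<Rightarrow>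
    (nat \<Rightarrow> real) \<Rightarrow> (nat \<Rightarrow> nat \<Rightarrow> real) \<Rightarrow> real" where
  "IE_hat n A \<mu> d \<tau> \<theta> M t x =
    1 / real n * ((\<Sum>i<n. mf_iter A \<mu> (ext_field d \<tau> \<theta> t x) M i)
                - (\<Sum>i<n. mf_iter A \<mu> (ext_field d \<tau> \<theta> (\<lambda>_. -1) x) M i))
    - 1/2 * DE_hat n A \<mu> d \<tau> \<theta> M t x"

definition expect_TX :: "nat \<Rightarrow> (nat \<Rightarrow> real) measure \<Rightarrow>
    ((nat \<Rightarrow> real) \<Rightarrow> (nat \<Rightarrow> nat \<Rightarrow> real) \<Rightarrow> real) \<Rightarrow> real" where
  "expect_TX n P F =
    (\<integral>(t, x). F t x \<partial>(uniform_count_measure (sign_vectors {..<n}) \<Otimes>\<^sub>M iid_rows n P))"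

end

theory Submission
  imports Defs
begin

text \<open>
  Fix \<open>t\<close> and \<open>x\<close>, and let \<open>h\<close> be the resulting external field. The mean of \<open>Y\<^sub>i\<close> under the Gibbs
  measure is the expectation of the conditional mean \<open>c\<^sub>i(Y) = \<langle>Y\<^sub>i | Y\<^sub>j, j \<noteq> i\<rangle>\<close>, and up to the
  influence of the diagonal entry \<open>A\<^sub>i\<^sub>i\<close> one has \<open>c\<^sub>i(Y) = \<alpha>'((A Y + h)\<^sub>i, 0)\<close>. Put
  \<open>\<xi> = Y - c(Y)\<close>. If \<open>A \<xi>\<close> is small, then \<open>c\<close> almost solves the mean-field equation
  \<open>c = \<alpha>'(A c + h, 0)\<close>. For \<open>\<parallel>A\<parallel>\<close> small the right-hand side is a contraction in Euclidean
  norm, because \<open>\<alpha>'\<close> is Lipschitz, so \<open>c\<close> is close to the mean-field iterates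
  (\<open>mf_iter_cond_mean\<close>), configuration by configuration.

  That \<open>A \<xi>\<close> is small comes from orthogonality. The residual \<open>\<xi>\<^sub>j\<close> is orthogonal to every
  function that does not depend on \<open>Y\<^sub>j\<close>, and \<open>\<xi>\<^sub>k\<close> depends on \<open>Y\<^sub>j\<close> only through the term
  \<open>A\<^sub>k\<^sub>j Y\<^sub>j\<close>; hence \<open>E \<xi>\<^sub>j \<xi>\<^sub>k = O(\<bar>A\<^sub>j\<^sub>k\<bar>)\<close> for \<open>j \<noteq> k\<close> (\<open>resid_covariance_le\<close>). Expanding
  \<open>E \<parallel>A \<xi>\<parallel>\<^sup>2 = \<Sum>\<^sub>j\<^sub>k (A\<^sup>2)\<^sub>j\<^sub>k E \<xi>\<^sub>j \<xi>\<^sub>k\<close> gives \<open>E \<parallel>A \<xi>\<parallel>\<^sup>2 = O(Tr A\<^sup>2) = o(n)\<close>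
  (\<open>resid_field_second_moment\<close>). Altogether, with \<open>u\<^sup>M\<close> the \<open>M\<close>-th iterate,
  \<open>\<Sum>\<^sub>i \<bar>u\<^sup>M\<^sub>i - \<langle>Y\<^sub>i\<rangle>\<bar> \<le> n (2\<^sup>-\<^sup>M + O(sqrt (Tr A\<^sup>2 / n)))\<close>, uniformly in \<open>h\<close>
  (\<open>gibbs_mean_near_mf_iter\<close>).

  It remains to write \<open>DE\<close> and \<open>IE\<close> in terms of a uniform sign vector \<open>T\<close>. Since \<open>T\<^sub>i\<close> is
  independent of the other signs, averaging \<open>\<langle>Y\<^sub>i\<rangle>\<close> at \<open>T\<^sub>i = 1\<close> minus \<open>\<langle>Y\<^sub>i\<rangle>\<close> at \<open>T\<^sub>i = -1\<close>
  gives \<open>2 E [T\<^sub>i \<langle>Y\<^sub>i\<rangle>]\<close>, and averaging \<open>\<langle>Y\<^sub>i\<rangle>\<close> at \<open>T\<^sub>i = -1\<close> gives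
  \<open>E \<langle>Y\<^sub>i\<rangle> - E [T\<^sub>i \<langle>Y\<^sub>i\<rangle>]\<close>. So the two effects are the expectations of the same functionals of
  the exact means that the estimators apply to \<open>u\<^sup>M\<close> (\<open>direct_effect_eq\<close>,
  \<open>indirect_effect_eq\<close>), and the errors are at most \<open>3/n\<close> times the sum above.

  The constant \<open>1/16\<close> makes \<open>\<parallel>A\<^sub>n\<parallel> \<le> 1/8\<close> eventually, and \<open>\<alpha>'\<close> is shown to be 4-Lipschitz, so
  that each iteration contracts by \<open>4 \<cdot> 1/8 = 1/2\<close>.
\<close>

section \<open>Means of one-site exponential tilts\<close>

text \<open>
  The mean of the probability measure proportional to \<open>exp (s z + a z\<^sup>2 / 2) d\<mu>(z)\<close>. This
  measure is the law of one spin given the others, with \<open>s\<close> the local field and \<open>a\<close> the diagonal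
  entry of the interaction; as \<open>alpha'_eq_site_mean\<close> below shows, its mean is also \<open>\<alpha>'(s, a)\<close>.
\<close>

definition site_mean :: "real measure \<Rightarrow> real \<Rightarrow> real \<Rightarrow> real" where
  "site_mean \<mu> s a =
    (\<integral>z. z * exp (s * z + a / 2 * z\<^sup>2) \<partial>\<mu>) / (\<integral>z. exp (s * z + a / 2 * z\<^sup>2) \<partial>\<mu>)"

lemma site_weight_le:
  fixes s a z :: real
  assumes "\<bar>z\<bar> \<le> 1"
  shows "exp (s * z + a / 2 * z\<^sup>2) \<le> exp (\<bar>s\<bar> + \<bar>a\<bar>)"
proof -
  have "s * z \<le> \<bar>s\<bar> * 1"
  proof -
    have "s * z \<le> \<bar>s\<bar> * \<bar>z\<bar>" by (simp flip: abs_mult)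
    also have "\<dots> \<le> \<bar>s\<bar> * 1" using assms by (intro mult_left_mono) auto
    finally show ?thesis .
  qed
  moreover have "a / 2 * z\<^sup>2 \<le> \<bar>a\<bar> * 1"
    using assms by (intro mult_mono) (auto simp: abs_square_le_1)
  ultimately show ?thesis by simp
qed

text \<open>
  Comparison of two normalised exponential densities whose exponents differ by at most \<open>\<delta>\<close>:
  numerator and normaliser each contribute a factor in \<open>[exp (- \<delta>), exp \<delta>]\<close>.
\<close>

lemma abs_normalised_exp_diff_le:
  fixes u v \<delta> Z Z' :: real
  assumes uv: "\<bar>u - v\<bar> \<le> \<delta>" and Z: "0 < Z" "0 < Z'" "exp (- \<delta>) * Z' \<le> Z" "Z \<le> exp \<delta> * Z'"
  shows "\<bar>exp u / Z - exp v / Z'\<bar> \<le> (exp (2 * \<delta>) - 1) * (exp v / Z')"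
proof -
  have up: "exp u / Z \<le> exp (2 * \<delta>) * (exp v / Z')"
  proof -
    have "exp u \<le> exp \<delta> * exp v"
      using uv by (simp flip: exp_add)
    then have "exp u / Z \<le> (exp \<delta> * exp v) / (exp (- \<delta>) * Z')"
      using Z by (intro frac_le) auto
    also have "\<dots> = exp (2 * \<delta>) * (exp v / Z')"
      using Z by (simp add: exp_minus field_simps flip: exp_add)
    finally show ?thesis .
  qed
  have lo: "exp (- (2 * \<delta>)) * (exp v / Z') \<le> exp u / Z"
  proof -
    have "exp (-\<delta>) * exp v \<le> exp u"
      using uv by (simp flip: exp_add)
    then have "(exp (-\<delta>) * exp v) / (exp \<delta> * Z') \<le> exp u / Z"
      using Z by (intro frac_le) auto
    also have "(exp (-\<delta>) * exp v) / (exp \<delta> * Z') = exp (- (2 * \<delta>)) * (exp v / Z')"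
      using Z by (simp add: exp_minus field_simps flip: exp_add)
    finally show ?thesis .
  qed
  \<comment> \<open>the deficit \<open>1 - exp (- 2 \<delta>)\<close> is at most the excess \<open>exp (2 \<delta>) - 1\<close>\<close>
  have "2 \<le> exp (2 * \<delta>) + exp (- (2 * \<delta>))"
    using exp_ge_add_one_self[of "2 * \<delta>"] exp_ge_add_one_self[of "- (2 * \<delta>)"] by linarith
  then have "2 * (exp v / Z') \<le> (exp (2 * \<delta>) + exp (- (2 * \<delta>))) * (exp v / Z')"
    using Z by (intro mult_right_mono) auto
  then have "exp v / Z' - exp (- (2 * \<delta>)) * (exp v / Z') \<le> (exp (2 * \<delta>) - 1) * (exp v / Z')"
    unfolding left_diff_distrib distrib_right by linarith
  moreover have "exp (2 * \<delta>) * (exp v / Z') - exp v / Z' = (exp (2 * \<delta>) - 1) * (exp v / Z')"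
    unfolding left_diff_distrib by simp
  ultimately show ?thesis using up lo unfolding abs_le_iff by linarith
qed

locale bounded_spin = prob_space \<mu> for \<mu> :: "real measure" +
  assumes sets_mu [measurable_cong]: "sets \<mu> = sets borel"
    and AE_mu: "AE y in \<mu>. y \<in> {-1..1}"
begin

lemma integrable_bounded_on_interval:
  fixes f :: "real \<Rightarrow> real"
  assumes "f \<in> borel_measurable borel" and "\<And>y. \<bar>y\<bar> \<le> 1 \<Longrightarrow> \<bar>f y\<bar> \<le> K"
  shows "integrable \<mu> f"
proof (rule integrable_const_bound[where B = K])
  show "AE x in \<mu>. norm (f x) \<le> K"
    using AE_mu by eventually_elim (use assms(2) in auto)
  show "f \<in> borel_measurable \<mu>"
    using assms(1) by (simp add: measurable_def sets_mu sets_eq_imp_space_eq[OF sets_mu])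
qed

lemma integrable_site_weight: "integrable \<mu> (\<lambda>z. exp (s * z + a / 2 * z\<^sup>2))"
  by (rule integrable_bounded_on_interval[where K = "exp (\<bar>s\<bar> + \<bar>a\<bar>)"])
    (use site_weight_le in auto)

lemma integrable_id_site_weight: "integrable \<mu> (\<lambda>z. z * exp (s * z + a / 2 * z\<^sup>2))"
proof (rule integrable_bounded_on_interval[where K = "exp (\<bar>s\<bar> + \<bar>a\<bar>)"])
  fix z :: real assume z: "\<bar>z\<bar> \<le> 1"
  have "\<bar>z\<bar> * exp (s * z + a / 2 * z\<^sup>2) \<le> 1 * exp (\<bar>s\<bar> + \<bar>a\<bar>)"
    by (intro mult_mono site_weight_le z) auto
  then show "\<bar>z * exp (s * z + a / 2 * z\<^sup>2)\<bar> \<le> exp (\<bar>s\<bar> + \<bar>a\<bar>)"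
    by (simp add: abs_mult)
qed auto

lemma site_normaliser_pos: "0 < (\<integral>z. exp (s * z + a / 2 * z\<^sup>2) \<partial>\<mu>)"
proof -
  have "(\<integral>z. 0 \<partial>\<mu>) < (\<integral>z. exp (s * z + a / 2 * z\<^sup>2) \<partial>\<mu>)"
    by (rule integral_less_AE_space) (use integrable_site_weight in \<open>auto simp: emeasure_space_1\<close>)
  then show ?thesis by simp
qed

text \<open>
  The one-site form of the orthogonality of residuals.
\<close>

lemma site_mean_centred:
  "(\<integral>z. exp (s * z + a / 2 * z\<^sup>2) * (z - site_mean \<mu> s a) \<partial>\<mu>) = 0"
proof -
  have "(\<integral>z. exp (s * z + a / 2 * z\<^sup>2) * (z - site_mean \<mu> s a) \<partial>\<mu>) =
     (\<integral>z. z * exp (s * z + a / 2 * z\<^sup>2) - site_mean \<mu> s a * exp (s * z + a / 2 * z\<^sup>2) \<partial>\<mu>)"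
    by (simp add: algebra_simps)
  also have "\<dots> = (\<integral>z. z * exp (s * z + a / 2 * z\<^sup>2) \<partial>\<mu>)
      - site_mean \<mu> s a * (\<integral>z. exp (s * z + a / 2 * z\<^sup>2) \<partial>\<mu>)"
    by (subst Bochner_Integration.integral_diff)
      (use integrable_id_site_weight integrable_site_weight in auto)
  also have "\<dots> = 0"
    using site_normaliser_pos[of s a] by (simp add: site_mean_def)
  finally show ?thesis .
qed

lemma site_mean_bounded: "\<bar>site_mean \<mu> s a\<bar> \<le> 1"
proof -
  have "\<bar>\<integral>z. z * exp (s * z + a / 2 * z\<^sup>2) \<partial>\<mu>\<bar> \<le> (\<integral>z. \<bar>z * exp (s * z + a / 2 * z\<^sup>2)\<bar> \<partial>\<mu>)"
    by (rule integral_abs_bound)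
  also have "\<dots> \<le> (\<integral>z. exp (s * z + a / 2 * z\<^sup>2) \<partial>\<mu>)"
  proof (rule integral_mono_AE)
    show "AE z in \<mu>. \<bar>z * exp (s * z + a / 2 * z\<^sup>2)\<bar> \<le> exp (s * z + a / 2 * z\<^sup>2)"
      using AE_mu by eventually_elim (auto simp: abs_mult)
  qed (use integrable_id_site_weight integrable_site_weight in auto)
  finally show ?thesis
    using site_normaliser_pos[of s a] by (simp add: site_mean_def)
qed

text \<open>
  On \<open>[-1, 1]\<close> the exponents differ by at most \<open>\<delta> = \<bar>s - s'\<bar> + \<bar>a - a'\<bar> / 2\<close>, so the densities
  differ in \<open>L\<^sup>1\<close> by at most \<open>exp (2 \<delta>) - 1\<close>, which is at most \<open>4 \<delta>\<close> when \<open>\<delta> \<le> 1/2\<close>; for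
  larger \<open>\<delta>\<close> the bound exceeds 2, the length of \<open>[-1, 1]\<close>.
  Having the two arguments vary together lets the same bound control the diagonal of \<open>A\<close>.
\<close>

lemma site_mean_lipschitz:
  "\<bar>site_mean \<mu> s a - site_mean \<mu> s' a'\<bar> \<le> 4 * (\<bar>s - s'\<bar> + \<bar>a - a'\<bar> / 2)"
proof -
  define \<delta> where "\<delta> = \<bar>s - s'\<bar> + \<bar>a - a'\<bar> / 2"
  define w w' where "w = (\<lambda>z. s * z + a / 2 * z\<^sup>2)" and "w' = (\<lambda>z. s' * z + a' / 2 * z\<^sup>2)"
  define Z Z' where "Z = (\<integral>z. exp (w z) \<partial>\<mu>)" and "Z' = (\<integral>z. exp (w' z) \<partial>\<mu>)"
  have int: "integrable \<mu> (\<lambda>z. exp (w z))" "integrable \<mu> (\<lambda>z. exp (w' z))"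
     "integrable \<mu> (\<lambda>z. z * exp (w z))" "integrable \<mu> (\<lambda>z. z * exp (w' z))"
    unfolding w_def w'_def by (rule integrable_site_weight integrable_id_site_weight)+
  have Z: "0 < Z" "0 < Z'"
    unfolding Z_def Z'_def w_def w'_def by (rule site_normaliser_pos)+
  have d0: "0 \<le> \<delta>" by (simp add: \<delta>_def)
  have ww: "\<bar>w z - w' z\<bar> \<le> \<delta>" if "z \<in> {-1..1}" for z
  proof -
    have z: "\<bar>z\<bar> \<le> 1" using that by auto
    have "w z - w' z = (s - s') * z + (a - a') / 2 * z\<^sup>2"
      by (simp add: w_def w'_def field_simps)
    also have "\<bar>\<dots>\<bar> \<le> \<bar>(s - s') * z\<bar> + \<bar>(a - a') / 2 * z\<^sup>2\<bar>" by (rule abs_triangle_ineq)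
    also have "\<dots> \<le> \<bar>s - s'\<bar> * 1 + \<bar>a - a'\<bar> / 2 * 1"
      unfolding abs_mult abs_divide using z
      by (intro add_mono mult_mono) (auto simp: abs_square_le_1)
    finally show ?thesis by (simp add: \<delta>_def)
  qed
  have "exp (- \<delta>) * Z' = (\<integral>z. exp (- \<delta>) * exp (w' z) \<partial>\<mu>)" by (simp add: Z'_def)
  also have "\<dots> \<le> Z" unfolding Z_def
  proof (rule integral_mono_AE)
    show "AE z in \<mu>. exp (- \<delta>) * exp (w' z) \<le> exp (w z)"
      using AE_mu by eventually_elim (use ww in \<open>fastforce simp flip: exp_add\<close>)
  qed (use int in auto)
  finally have Zlo: "exp (- \<delta>) * Z' \<le> Z" .
  have "Z \<le> (\<integral>z. exp \<delta> * exp (w' z) \<partial>\<mu>)" unfolding Z_def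
  proof (rule integral_mono_AE)
    show "AE z in \<mu>. exp (w z) \<le> exp \<delta> * exp (w' z)"
      using AE_mu by eventually_elim (use ww in \<open>fastforce simp flip: exp_add\<close>)
  qed (use int in auto)
  then have Zup: "Z \<le> exp \<delta> * Z'" by (simp add: Z'_def)
  have "site_mean \<mu> s a - site_mean \<mu> s' a' =
      (\<integral>z. z * exp (w z) / Z - z * exp (w' z) / Z' \<partial>\<mu>)"
    using int by (simp add: site_mean_def Z_def Z'_def w_def w'_def)
  also have "\<dots> = (\<integral>z. z * (exp (w z) / Z - exp (w' z) / Z') \<partial>\<mu>)"
    by (simp add: algebra_simps)
  also have "\<bar>\<dots>\<bar> \<le> (\<integral>z. \<bar>z * (exp (w z) / Z - exp (w' z) / Z')\<bar> \<partial>\<mu>)"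
    by (rule integral_abs_bound)
  also have "\<dots> \<le> (\<integral>z. (exp (2 * \<delta>) - 1) * (exp (w' z) / Z') \<partial>\<mu>)"
  proof (rule integral_mono_AE)
    show "AE z in \<mu>. \<bar>z * (exp (w z) / Z - exp (w' z) / Z')\<bar> \<le> (exp (2 * \<delta>) - 1) * (exp (w' z) / Z')"
      using AE_mu
    proof eventually_elim
      case (elim z)
      have "\<bar>z\<bar> * \<bar>exp (w z) / Z - exp (w' z) / Z'\<bar> \<le> 1 * \<bar>exp (w z) / Z - exp (w' z) / Z'\<bar>"
        using elim by (intro mult_right_mono) auto
      also have "\<dots> \<le> (exp (2 * \<delta>) - 1) * (exp (w' z) / Z')"
        using abs_normalised_exp_diff_le[OF ww[OF elim] Z Zlo Zup] by simp
      finally show ?case by (simp add: abs_mult)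
    qed
    have "integrable \<mu> (\<lambda>z. z * exp (w z) / Z - z * exp (w' z) / Z')" using int by simp
    then have "integrable \<mu> (\<lambda>z. z * (exp (w z) / Z - exp (w' z) / Z'))"
      by (simp add: algebra_simps)
    then show "integrable \<mu> (\<lambda>z. \<bar>z * (exp (w z) / Z - exp (w' z) / Z')\<bar>)" by simp
  qed (use int in auto)
  also have "\<dots> = exp (2 * \<delta>) - 1"
    using Z by (simp add: Z'_def)
  finally have main: "\<bar>site_mean \<mu> s a - site_mean \<mu> s' a'\<bar> \<le> exp (2 * \<delta>) - 1" .
  show ?thesis
  proof (cases "\<delta> \<le> 1/2")
    case True
    then have "exp (2 * \<delta>) \<le> 1 + 2 * \<delta> + (2 * \<delta>)\<^sup>2" using d0 by (intro exp_bound) auto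
    moreover have "(2 * \<delta>)\<^sup>2 \<le> 2 * \<delta>"
      using True d0 mult_left_mono[of "2*\<delta>" 1 "2*\<delta>"] by (simp add: power2_eq_square)
    ultimately show ?thesis using main by (simp flip: \<delta>_def)
  next
    case False
    then show ?thesis using site_mean_bounded[of s a] site_mean_bounded[of s' a']
      by (simp flip: \<delta>_def)
  qed
qed

lemma measurable_site_mean [measurable]: "(\<lambda>s. site_mean \<mu> s a) \<in> borel_measurable borel"
proof (rule borel_measurable_continuous_onI)
  have "4-lipschitz_on UNIV (\<lambda>s. site_mean \<mu> s a)"
    using site_mean_lipschitz[of _ a _ a] by (intro lipschitz_onI) (auto simp: dist_real_def)
  then show "continuous_on UNIV (\<lambda>s. site_mean \<mu> s a)"
    by (rule lipschitz_on_continuous_on)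
qed

text \<open>
  Differentiation under the integral sign, by the pointwise bound
  \<open>\<bar>exp x - 1 - x\<bar> \<le> x\<^sup>2\<close> for \<open>\<bar>x\<bar> \<le> 1\<close>, applied with \<open>x = t z\<close>.
\<close>

lemma site_normaliser_has_derivative:
  "((\<lambda>s. \<integral>z. exp (s * z + a / 2 * z\<^sup>2) \<partial>\<mu>) has_field_derivative
      (\<integral>z. z * exp (s * z + a / 2 * z\<^sup>2) \<partial>\<mu>)) (at s)"
proof -
  define F where "F = (\<lambda>s. \<integral>z. exp (s * z + a / 2 * z\<^sup>2) \<partial>\<mu>)"
  define D where "D = (\<integral>z. z * exp (s * z + a / 2 * z\<^sup>2) \<partial>\<mu>)"
  define K where "K = exp (\<bar>s\<bar> + \<bar>a\<bar>)"
  have quad: "\<bar>exp x - 1 - x\<bar> \<le> x\<^sup>2" if "\<bar>x\<bar> \<le> 1" for x :: real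
  proof (cases "0 \<le> x")
    case True
    then have "exp x \<le> 1 + x + x\<^sup>2" using that by (intro exp_bound) auto
    moreover have "0 \<le> x\<^sup>2" by simp
    ultimately show ?thesis using exp_ge_add_one_self[of x] by linarith
  next
    case False
    have "exp x \<le> 1 / (1 - x)"
      using exp_ge_add_one_self[of "- x"] False by (simp add: exp_minus field_simps)
    also have "\<dots> \<le> 1 + x + x\<^sup>2"
    proof -
      have "1 \<le> (1 + x + x\<^sup>2) * (1 - x)"
      proof -
        have "(1 + x + x\<^sup>2) * (1 - x) = 1 - x ^ 3" by (simp add: power2_eq_square power3_eq_cube algebra_simps)
        moreover have "x ^ 3 \<le> 0" using False by (simp add: power3_eq_cube mult_le_0_iff zero_le_mult_iff)
        ultimately show ?thesis by simp
      qed
      then show ?thesis using False by (simp add: pos_divide_le_eq)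
    qed
    finally have "exp x \<le> 1 + x + x\<^sup>2" .
    moreover have "0 \<le> x\<^sup>2" by simp
    ultimately show ?thesis using exp_ge_add_one_self[of x] by linarith
  qed
  define e where "e = (\<lambda>r z. exp (r * z + a / 2 * z\<^sup>2))"
  have F: "F = (\<lambda>r. \<integral>z. e r z \<partial>\<mu>)" and D: "D = (\<integral>z. z * e s z \<partial>\<mu>)"
    by (simp_all add: F_def D_def e_def)
  have int: "integrable \<mu> (e r)" "integrable \<mu> (\<lambda>z. z * e r z)" for r
    unfolding e_def by (rule integrable_site_weight integrable_id_site_weight)+
  have est: "\<bar>(F (s + t) - F s) / t - D\<bar> \<le> K * \<bar>t\<bar>" if t: "t \<noteq> 0" "\<bar>t\<bar> \<le> 1" for t
  proof -
    have "F (s + t) - F s - t * D = (\<integral>z. e (s + t) z - e s z - t * (z * e s z) \<partial>\<mu>)"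
      unfolding F D using int by simp
    also have "\<bar>\<dots>\<bar> \<le> (\<integral>z. \<bar>e (s + t) z - e s z - t * (z * e s z)\<bar> \<partial>\<mu>)"
      by (rule integral_abs_bound)
    also have "\<dots> \<le> (\<integral>z. K * t\<^sup>2 \<partial>\<mu>)"
    proof (rule integral_mono_AE)
      show "AE z in \<mu>. \<bar>e (s + t) z - e s z - t * (z * e s z)\<bar> \<le> K * t\<^sup>2"
        using AE_mu
      proof eventually_elim
        case (elim z)
        have z: "\<bar>z\<bar> \<le> 1" using elim by auto
        have tz: "\<bar>t * z\<bar> \<le> 1" using mult_mono[OF t(2) z] by (simp add: abs_mult)
        have "e (s + t) z = e s z * exp (t * z)"
          by (simp add: e_def algebra_simps flip: exp_add)
        then have "e (s + t) z - e s z - t * (z * e s z) = e s z * (exp (t * z) - 1 - t * z)"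
          by (simp add: algebra_simps)
        also have "\<bar>\<dots>\<bar> = e s z * \<bar>exp (t * z) - 1 - t * z\<bar>"
          by (simp add: abs_mult e_def)
        also have "\<dots> \<le> K * (t * z)\<^sup>2"
          unfolding K_def e_def by (intro mult_mono site_weight_le z quad tz) auto
        also have "\<dots> \<le> K * t\<^sup>2"
        proof -
          have "z\<^sup>2 \<le> 1" using z by (simp add: abs_square_le_1)
          then have "(t * z)\<^sup>2 \<le> t\<^sup>2" by (simp add: power_mult_distrib mult_left_le)
          then show ?thesis by (simp add: K_def)
        qed
        finally show ?case .
      qed
    qed (use int in auto)
    finally have "\<bar>F (s + t) - F s - t * D\<bar> \<le> K * t\<^sup>2" by (simp add: prob_space)
    moreover have "(F (s + t) - F s) / t - D = (F (s + t) - F s - t * D) / t"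
      using t by (simp add: field_simps)
    ultimately have "\<bar>(F (s + t) - F s) / t - D\<bar> \<le> K * t\<^sup>2 / \<bar>t\<bar>"
      by (simp add: abs_divide divide_right_mono)
    also have "\<dots> = K * \<bar>t\<bar>" using t by (simp add: power2_eq_square divide_simps abs_if)
    finally show ?thesis .
  qed
  have "((\<lambda>t. (F (s + t) - F s) / t - D) \<longlongrightarrow> 0) (at 0)"
  proof (rule Lim_null_comparison)
    show "((\<lambda>t. K * \<bar>t\<bar>) \<longlongrightarrow> 0) (at 0)" by (auto intro!: tendsto_eq_intros)
    show "\<forall>\<^sub>F t in at 0. norm ((F (s + t) - F s) / t - D) \<le> K * \<bar>t\<bar>"
      unfolding eventually_at by (rule exI[of _ 1]) (use est in \<open>auto simp: dist_real_def\<close>)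
  qed
  then have "((\<lambda>t. (F (s + t) - F s) / t) \<longlongrightarrow> D) (at 0)" by (rule LIM_zero_cancel)
  then show ?thesis unfolding DERIV_def F_def D_def .
qed

lemma alpha'_eq_site_mean: "alpha' \<mu> s a = site_mean \<mu> s a"
  unfolding alpha'_def alpha_def
proof (rule DERIV_imp_deriv)
  show "((\<lambda>s. ln (\<integral>z. exp (s * z + a / 2 * z\<^sup>2) \<partial>\<mu>)) has_field_derivative site_mean \<mu> s a) (at s)"
    by (rule DERIV_cong[OF DERIV_chain2[OF DERIV_ln[OF site_normaliser_pos]
            site_normaliser_has_derivative]])
      (unfold site_mean_def divide_inverse, rule mult.commute)
qed

end

section \<open>Operator norm and Euclidean estimates\<close>

lemma mat_apply_eq_sum: "A \<in> carrier_mat n n \<Longrightarrow> mat_apply A u i = (\<Sum>j<n. A $$ (i, j) * u j)"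
  by (auto simp: mat_apply_def)

text \<open>
  The supremum in \<open>op_norm\<close> is over reals, so using it requires that the set is bounded above; the
  sum of the absolute values of the entries is a bound.
\<close>

lemma L2_set_mat_apply_le_op_norm:
  assumes A: "A \<in> carrier_mat n n" and v: "L2_set v {..<n} \<le> 1"
  shows "L2_set (mat_apply A v) {..<n} \<le> op_norm A"
proof -
  define K where "K = (\<Sum>i<n. \<Sum>j<n. \<bar>A $$ (i, j)\<bar>)"
  have bound: "L2_set (mat_apply A v) {..<n} \<le> K" if v: "L2_set v {..<n} \<le> 1" for v
  proof -
    have "L2_set (mat_apply A v) {..<n} \<le> (\<Sum>i<n. \<bar>mat_apply A v i\<bar>)" by (rule L2_set_le_sum_abs)
    also have "\<dots> \<le> K" unfolding K_def
    proof (rule sum_mono)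
      fix i
      have "\<bar>mat_apply A v i\<bar> \<le> (\<Sum>j<n. \<bar>A $$ (i, j) * v j\<bar>)"
        unfolding mat_apply_eq_sum[OF A] by (rule sum_abs)
      also have "\<dots> \<le> (\<Sum>j<n. \<bar>A $$ (i, j)\<bar>)"
      proof (rule sum_mono)
        fix j assume j: "j \<in> {..<n}"
        have "\<bar>v j\<bar> \<le> L2_set (\<lambda>j. \<bar>v j\<bar>) {..<n}" using j by (intro member_le_L2_set) auto
        also have "\<dots> = L2_set v {..<n}" by (simp add: L2_set_def)
          finally have "\<bar>v j\<bar> \<le> 1" using v by linarith
        then show "\<bar>A $$ (i, j) * v j\<bar> \<le> \<bar>A $$ (i, j)\<bar>" by (simp add: abs_mult mult_left_le)
      qed
      finally show "\<bar>mat_apply A v i\<bar> \<le> (\<Sum>j<n. \<bar>A $$ (i, j)\<bar>)" .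
    qed
    finally show ?thesis .
  qed
  have dims: "dim_col A = n" "dim_row A = n" using A by auto
  show ?thesis
    unfolding op_norm_def dims
    by (rule cSUP_upper) (use v bound in \<open>auto intro!: bdd_aboveI2[where M = K]\<close>)
qed

lemma op_norm_nonneg: "A \<in> carrier_mat n n \<Longrightarrow> 0 \<le> op_norm A"
  by (rule order_trans[OF L2_set_nonneg L2_set_mat_apply_le_op_norm[of A n "\<lambda>_. 0"]])
    (auto simp: L2_set_def)

lemma L2_set_mat_apply_le:
  assumes A: "A \<in> carrier_mat n n"
  shows "L2_set (mat_apply A u) {..<n} \<le> op_norm A * L2_set u {..<n}"
proof -
  define r where "r = L2_set u {..<n}"
  show ?thesis
  proof (cases "r = 0")
    case True
    then have "u j = 0" if "j < n" for j using that by (auto simp: r_def L2_set_eq_0_iff)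
    then have "mat_apply A u i = 0" for i by (simp add: mat_apply_eq_sum[OF A])
    then show ?thesis using True by (simp add: r_def L2_set_def)
  next
    case False
    then have r: "r > 0" using L2_set_nonneg[of u "{..<n}"] by (simp add: r_def less_le)
    have "L2_set (\<lambda>j. u j / r) {..<n} = 1"
      using L2_set_right_distrib[of "1/r" u "{..<n}"] r by (simp add: r_def)
    then have "L2_set (mat_apply A (\<lambda>j. u j / r)) {..<n} \<le> op_norm A" by (intro L2_set_mat_apply_le_op_norm A) simp
    also have "mat_apply A (\<lambda>j. u j / r) = (\<lambda>i. 1 / r * mat_apply A u i)"
      by (simp add: mat_apply_eq_sum[OF A] sum_distrib_left fun_eq_iff)
    also have "L2_set \<dots> {..<n} = 1 / r * L2_set (mat_apply A u) {..<n}"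
      using r by (intro L2_set_right_distrib[symmetric]) auto
    finally show ?thesis using r by (simp add: r_def[symmetric] field_simps)
  qed
qed

definition frob_sq :: "nat \<Rightarrow> real mat \<Rightarrow> real" where
  "frob_sq n A = (\<Sum>i<n. \<Sum>j<n. (A $$ (i, j))\<^sup>2)"

lemma frob_sq_nonneg: "0 \<le> frob_sq n A"
  by (auto simp: frob_sq_def intro!: sum_nonneg)

lemma symmetric_mat_index:
  assumes "A \<in> carrier_mat n n" "transpose_mat A = A" "i < n" "j < n"
  shows "A $$ (i, j) = A $$ (j, i)"
  using assms by (metis carrier_matD index_transpose_mat(1))

lemma mat_trace_square:
  assumes A: "A \<in> carrier_mat n n" "transpose_mat A = A"
  shows "mat_trace (A ^\<^sub>m 2) = frob_sq n A"
proof -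
  have "A ^\<^sub>m 2 = A * A" using A by (simp add: numeral_2_eq_2)
  then have "mat_trace (A ^\<^sub>m 2) = (\<Sum>i<n. \<Sum>j<n. A $$ (i, j) * A $$ (j, i))"
    using A by (auto simp: mat_trace_def scalar_prod_def atLeast0LessThan intro!: sum.cong)
  also have "\<dots> = frob_sq n A"
    unfolding frob_sq_def power2_eq_square
    by (intro sum.cong refl) (use symmetric_mat_index[OF A] in auto)
  finally show ?thesis .
qed

text \<open>
  The inequality \<open>\<parallel>A\<^sup>2\<parallel>\<^sub>F \<le> \<parallel>A\<parallel> \<parallel>A\<parallel>\<^sub>F\<close>: each column of \<open>A\<^sup>2\<close> is \<open>A\<close> applied to a column of \<open>A\<close>.
\<close>

lemma gram_sum_squares_le:
  assumes A: "A \<in> carrier_mat n n" "transpose_mat A = A"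
  shows "(\<Sum>j<n. \<Sum>k<n. (\<Sum>i<n. A $$ (i, j) * A $$ (i, k))\<^sup>2) \<le> (op_norm A)\<^sup>2 * frob_sq n A"
proof -
  have col: "(\<Sum>k<n. (\<Sum>i<n. A $$ (i, j) * A $$ (i, k))\<^sup>2) \<le> (op_norm A)\<^sup>2 * (\<Sum>i<n. (A $$ (i, j))\<^sup>2)"
    if j: "j < n" for j
  proof -
    have "(\<Sum>k<n. (\<Sum>i<n. A $$ (i, j) * A $$ (i, k))\<^sup>2) = (L2_set (mat_apply A (\<lambda>i. A $$ (i, j))) {..<n})\<^sup>2"
      unfolding L2_set_def mat_apply_eq_sum[OF A(1)]
      by (subst real_sqrt_pow2)
        (auto intro!: sum_nonneg sum.cong arg_cong[where f = "\<lambda>x. x\<^sup>2"]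
           simp: symmetric_mat_index[OF A, of _ _] mult.commute)
    also have "\<dots> \<le> (op_norm A * L2_set (\<lambda>i. A $$ (i, j)) {..<n})\<^sup>2"
      by (intro power_mono L2_set_mat_apply_le A L2_set_nonneg)
    also have "\<dots> = (op_norm A)\<^sup>2 * (\<Sum>i<n. (A $$ (i, j))\<^sup>2)"
      by (simp add: L2_set_def power_mult_distrib sum_nonneg)
    finally show ?thesis .
  qed
  have "(\<Sum>j<n. \<Sum>k<n. (\<Sum>i<n. A $$ (i, j) * A $$ (i, k))\<^sup>2)
      \<le> (\<Sum>j<n. (op_norm A)\<^sup>2 * (\<Sum>i<n. (A $$ (i, j))\<^sup>2))"
    by (intro sum_mono col) auto
  also have "\<dots> = (op_norm A)\<^sup>2 * frob_sq n A"
    unfolding frob_sq_def sum_distrib_left by (rule sum.swap)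
  finally show ?thesis .
qed

lemma diagonal_L2_le: "L2_set (\<lambda>i. A $$ (i, i)) {..<n} \<le> sqrt (frob_sq n A)"
  unfolding L2_set_def frob_sq_def
  by (intro real_sqrt_le_mono sum_mono) (auto intro: member_le_sum)

lemma L2_set_mono_abs:
  assumes "\<And>i. i \<in> K \<Longrightarrow> \<bar>f i\<bar> \<le> g i"
  shows "L2_set f K \<le> L2_set g K"
  unfolding L2_set_def
proof (intro real_sqrt_le_mono sum_mono)
  fix i assume "i \<in> K"
  then have "\<bar>f i\<bar>\<^sup>2 \<le> (g i)\<^sup>2" by (intro power_mono assms) auto
  then show "(f i)\<^sup>2 \<le> (g i)\<^sup>2" by simp
qed

lemma L2_set_abs_eq: "L2_set (\<lambda>i. \<bar>f i\<bar>) K = L2_set f K"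
  by (simp add: L2_set_def)

section \<open>The Gibbs measure\<close>

text \<open>
  The field \<open>h\<close> is arbitrary throughout, so every bound proved in this locale is uniform over the
  treatments and covariates.
\<close>

locale gibbs_model = bounded_spin \<mu> for \<mu> :: "real measure" +
  fixes n :: nat and A :: "real mat" and h :: "nat \<Rightarrow> real"
  assumes carrier: "A \<in> carrier_mat n n" and sym: "transpose_mat A = A"
begin

abbreviation "N \<equiv> \<Pi>\<^sub>M i\<in>{..<n}. \<mu>"
abbreviation "G \<equiv> gibbs n A \<mu> h"

lemma mat_apply_eq: "mat_apply A u i = (\<Sum>j<n. A $$ (i, j) * u j)"
  by (rule mat_apply_eq_sum[OF carrier])

lemma A_sym: "i < n \<Longrightarrow> j < n \<Longrightarrow> A $$ (i, j) = A $$ (j, i)"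
  by (rule symmetric_mat_index[OF carrier sym])

sublocale base: product_prob_space "\<lambda>_. \<mu>" "{..<n}"
  by unfold_locales

lemma measurable_coordinate [measurable]: "i < n \<Longrightarrow> (\<lambda>y. y i) \<in> borel_measurable N"
  using measurable_component_singleton[of i "{..<n}" "\<lambda>_. \<mu>"]
  by (simp add: measurable_cong_sets[OF refl sets_mu])

lemma AE_base_cube: "AE y in N. \<forall>i<n. \<bar>y i\<bar> \<le> 1"
proof -
  have "AE y in N. \<bar>y i\<bar> \<le> 1" if "i \<in> {..<n}" for i
    by (rule AE_PiM_component[OF _ that]) (use AE_mu prob_space_axioms in \<open>auto elim: AE_mp\<close>)
  then have "AE y in N. \<forall>i\<in>{..<n}. \<bar>y i\<bar> \<le> 1"
    by (subst AE_ball_countable) (auto intro: countable_finite)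
  then show ?thesis by (auto elim: AE_mp)
qed

lemma measurable_gibbs_weight [measurable]: "gibbs_weight n A h \<in> borel_measurable N"
  unfolding gibbs_weight_def mat_apply_eq by measurable

lemma gibbs_weight_bounded:
  obtains K where "\<And>y. (\<And>i. i < n \<Longrightarrow> \<bar>y i\<bar> \<le> 1) \<Longrightarrow> gibbs_weight n A h y \<le> K"
proof
  fix y :: "nat \<Rightarrow> real" assume y: "\<And>i. i < n \<Longrightarrow> \<bar>y i\<bar> \<le> 1"
  have "(\<Sum>i<n. y i * mat_apply A y i) \<le> (\<Sum>i<n. \<Sum>j<n. \<bar>A $$ (i, j)\<bar>)"
    unfolding mat_apply_eq sum_distrib_left
  proof (intro sum_mono)
    fix i j assume ij: "i \<in> {..<n}" "j \<in> {..<n}"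
    have "y i * (A $$ (i, j) * y j) \<le> \<bar>y i\<bar> * (\<bar>A $$ (i, j)\<bar> * \<bar>y j\<bar>)"
      by (simp flip: abs_mult)
    also have "\<dots> \<le> 1 * (\<bar>A $$ (i, j)\<bar> * 1)"
      using ij y by (intro mult_mono) auto
    finally show "y i * (A $$ (i, j) * y j) \<le> \<bar>A $$ (i, j)\<bar>" by simp
  qed
  moreover have "(\<Sum>i<n. y i * h i) \<le> (\<Sum>i<n. \<bar>h i\<bar>)"
  proof (intro sum_mono)
    fix i assume i: "i \<in> {..<n}"
    have "y i * h i \<le> \<bar>y i\<bar> * \<bar>h i\<bar>" by (simp flip: abs_mult)
    also have "\<dots> \<le> 1 * \<bar>h i\<bar>" using i y by (intro mult_mono) auto
    finally show "y i * h i \<le> \<bar>h i\<bar>" by simp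
  qed
  ultimately show "gibbs_weight n A h y
      \<le> exp (1/2 * (\<Sum>i<n. \<Sum>j<n. \<bar>A $$ (i, j)\<bar>) + (\<Sum>i<n. \<bar>h i\<bar>))"
    by (simp add: gibbs_weight_def)
qed

lemma integrable_weighted:
  assumes [measurable]: "f \<in> borel_measurable N"
    and f: "\<And>y. (\<And>i. i < n \<Longrightarrow> \<bar>y i\<bar> \<le> 1) \<Longrightarrow> \<bar>f y\<bar> \<le> (K :: real)"
  shows "integrable N (\<lambda>y. gibbs_weight n A h y * f y)"
proof -
  obtain W where W: "\<And>y. (\<And>i. i < n \<Longrightarrow> \<bar>y i\<bar> \<le> 1) \<Longrightarrow> gibbs_weight n A h y \<le> W"
    using gibbs_weight_bounded by blast
  show ?thesis
  proof (rule base.integrable_const_bound[where B = "W * K"])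
    show "AE y in N. norm (gibbs_weight n A h y * f y) \<le> W * K"
      using AE_base_cube
    proof eventually_elim
      case (elim y)
      have "0 \<le> gibbs_weight n A h y" by (simp add: gibbs_weight_def)
      then have "gibbs_weight n A h y * \<bar>f y\<bar> \<le> W * K"
        using elim W[of y] f[of y] by (intro mult_mono) auto
      then show ?case by (simp add: abs_mult gibbs_weight_def)
    qed
  qed measurable
qed

lemma gibbs_weight_pos: "0 < gibbs_weight n A h y"
  by (simp add: gibbs_weight_def)

lemma integrable_gibbs_weight: "integrable N (gibbs_weight n A h)"
  using integrable_weighted[of "\<lambda>_. 1" 1] by simp

lemma gibbs_Z_pos: "0 < gibbs_Z n A \<mu> h"
proof -
  have "(\<integral>y. 0 \<partial>N) < (\<integral>y. gibbs_weight n A h y \<partial>N)"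
    by (rule base.integral_less_AE_space)
      (use integrable_gibbs_weight gibbs_weight_pos base.emeasure_space_1 in auto)
  then show ?thesis by (simp add: gibbs_Z_def)
qed

lemma sets_gibbs [measurable_cong]: "sets G = sets N"
  by (simp add: gibbs_def)

lemma gibbs_expectation:
  assumes [measurable]: "f \<in> borel_measurable N"
  shows "(\<integral>y. f y \<partial>G) = (\<integral>y. gibbs_weight n A h y * (f y :: real) \<partial>N) / gibbs_Z n A \<mu> h"
proof -
  have "(\<integral>y. f y \<partial>G) = (\<integral>y. gibbs_weight n A h y / gibbs_Z n A \<mu> h * f y \<partial>N)"
    unfolding gibbs_def
    by (subst integral_density) (use gibbs_Z_pos gibbs_weight_pos in \<open>auto intro!: divide_nonneg_pos less_imp_le\<close>)
  then show ?thesis by simp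
qed

sublocale gibbs: prob_space G
proof
  have "emeasure G (space G) = (\<integral>\<^sup>+ y. ennreal (gibbs_weight n A h y / gibbs_Z n A \<mu> h) \<partial>N)"
    unfolding gibbs_def by (subst emeasure_density) (auto intro!: nn_integral_cong)
  also have "\<dots> = ennreal (\<integral>y. gibbs_weight n A h y / gibbs_Z n A \<mu> h \<partial>N)"
    using gibbs_Z_pos gibbs_weight_pos integrable_gibbs_weight
    by (intro nn_integral_eq_integral) (auto intro!: divide_nonneg_pos less_imp_le)
  also have "(\<integral>y. gibbs_weight n A h y / gibbs_Z n A \<mu> h \<partial>N) = 1"
    using gibbs_Z_pos by (simp add: gibbs_Z_def)
  finally show "emeasure G (space G) = 1" by simp
qed

lemma AE_gibbs_cube: "AE y in G. \<forall>i<n. \<bar>y i\<bar> \<le> 1"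
  unfolding gibbs_def by (subst AE_density) (use AE_base_cube in auto)

lemma integrable_gibbs:
  assumes [measurable]: "f \<in> borel_measurable N"
    and f: "\<And>y. (\<And>i. i < n \<Longrightarrow> \<bar>y i\<bar> \<le> 1) \<Longrightarrow> \<bar>f y\<bar> \<le> (K :: real)"
  shows "integrable G f"
proof (rule gibbs.integrable_const_bound[where B = K])
  show "AE y in G. norm (f y) \<le> K"
    using AE_gibbs_cube by eventually_elim (use f in auto)
qed measurable

section \<open>Residuals of the conditional means\<close>

text \<open>
  The field felt by spin \<open>i\<close> from the other spins; the self-interaction \<open>A\<^sub>i\<^sub>i\<close> is kept apart, as the
  second argument of \<open>site_mean\<close>, so that \<open>cond_mean i\<close> is the exact conditional mean of \<open>y i\<close>.
\<close>

definition rest_field :: "nat \<Rightarrow> (nat \<Rightarrow> real) \<Rightarrow> real" where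
  "rest_field i y = h i + (\<Sum>j\<in>{..<n} - {i}. A $$ (i, j) * y j)"

definition cond_mean :: "nat \<Rightarrow> (nat \<Rightarrow> real) \<Rightarrow> real" where
  "cond_mean i y = site_mean \<mu> (rest_field i y) (A $$ (i, i))"

definition resid :: "nat \<Rightarrow> (nat \<Rightarrow> real) \<Rightarrow> real" where
  "resid i y = y i - cond_mean i y"

lemma measurable_rest_field [measurable]: "i < n \<Longrightarrow> rest_field i \<in> borel_measurable N"
  unfolding rest_field_def by measurable

lemma measurable_cond_mean [measurable]: "i < n \<Longrightarrow> cond_mean i \<in> borel_measurable N"
  unfolding cond_mean_def by measurable

lemma measurable_resid [measurable]: "i < n \<Longrightarrow> resid i \<in> borel_measurable N"
  unfolding resid_def by measurable

lemma cond_mean_bounded: "\<bar>cond_mean i y\<bar> \<le> 1"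
  unfolding cond_mean_def by (rule site_mean_bounded)

lemma resid_bounded:
  assumes "i < n" "\<And>j. j < n \<Longrightarrow> \<bar>y j\<bar> \<le> 1"
  shows "\<bar>resid i y\<bar> \<le> 2"
  using cond_mean_bounded[of i y] assms(2)[OF assms(1)] unfolding resid_def by linarith

lemma rest_field_update: "rest_field i (y(i := z)) = rest_field i y"
  unfolding rest_field_def by (auto intro!: sum.cong)

lemma rest_field_split:
  assumes "j < n" "j \<noteq> k"
  shows "rest_field k y =
    h k + (\<Sum>l\<in>{..<n} - {k} - {j}. A $$ (k, l) * y l) + A $$ (k, j) * y j"
  unfolding rest_field_def using assms by (subst sum.remove[of _ j]) auto

text \<open>
  As a function of the single coordinate \<open>y i\<close>, the Gibbs weight is a one-site exponential tilt; the
  symmetry of \<open>A\<close> merges the two cross terms.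
\<close>

lemma gibbs_weight_update:
  assumes i: "i < n"
  obtains c where "\<And>z. gibbs_weight n A h (y(i := z)) =
    c * exp (rest_field i y * z + A $$ (i, i) / 2 * z\<^sup>2)"
proof
  let ?I = "{..<n} - {i}"
  define R where "R = (\<Sum>j\<in>?I. y j * (\<Sum>k\<in>?I. A $$ (j, k) * y k))"
  define L where "L = (\<Sum>j\<in>?I. A $$ (i, j) * y j)"
  fix z
  have mi: "mat_apply A (y(i := z)) i = A $$ (i, i) * z + L"
    unfolding mat_apply_eq L_def using i by (subst sum.remove[of _ i]) (auto intro!: sum.cong)
  have mj: "mat_apply A (y(i := z)) j = A $$ (i, j) * z + (\<Sum>k\<in>?I. A $$ (j, k) * y k)"
    if "j \<in> ?I" for j
    unfolding mat_apply_eq using i that A_sym[of i j]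
    by (subst sum.remove[of _ i]) (auto intro!: sum.cong)
  have "(\<Sum>j<n. (y(i := z)) j * mat_apply A (y(i := z)) j) =
      z * mat_apply A (y(i := z)) i + (\<Sum>j\<in>?I. y j * mat_apply A (y(i := z)) j)"
    using i by (subst sum.remove[of _ i]) (auto intro!: sum.cong)
  also have "(\<Sum>j\<in>?I. y j * mat_apply A (y(i := z)) j) = L * z + R"
    by (simp add: mj L_def R_def sum_distrib_left sum_distrib_right sum.distrib algebra_simps)
  also have "z * mat_apply A (y(i := z)) i + (L * z + R) = A $$ (i, i) * z\<^sup>2 + 2 * L * z + R"
    unfolding mi by (simp add: algebra_simps power2_eq_square)
  finally have quad: "(\<Sum>j<n. (y(i := z)) j * mat_apply A (y(i := z)) j) =
      A $$ (i, i) * z\<^sup>2 + 2 * L * z + R" .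
  have lin: "(\<Sum>j<n. (y(i := z)) j * h j) = z * h i + (\<Sum>j\<in>?I. y j * h j)"
    using i by (subst sum.remove[of _ i]) (auto intro!: sum.cong)
  show "gibbs_weight n A h (y(i := z)) = exp (1/2 * R + (\<Sum>j\<in>?I. y j * h j)) *
      exp (rest_field i y * z + A $$ (i, i) / 2 * z\<^sup>2)"
    unfolding gibbs_weight_def quad lin rest_field_def L_def[symmetric]
    by (simp add: algebra_simps flip: exp_add)
qed

text \<open>
  Integrate the coordinate \<open>i\<close> first. With the others fixed, the Gibbs weight is
  a one-site tilt whose mean is \<open>cond_mean i y\<close>, so the inner integral vanishes.
\<close>

lemma resid_orthogonal:
  assumes i: "i < n" and [measurable]: "g \<in> borel_measurable N"
    and g: "\<And>y. (\<And>i. i < n \<Longrightarrow> \<bar>y i\<bar> \<le> 1) \<Longrightarrow> \<bar>g y\<bar> \<le> K"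
    and indep: "\<And>y z. g (y(i := z)) = g y"
  shows "(\<integral>y. resid i y * g y \<partial>G) = 0"
proof -
  define f where "f = (\<lambda>y. gibbs_weight n A h y * (resid i y * g y))"
  have ins: "insert i ({..<n} - {i}) = {..<n}" using i by auto
  have f: "integrable N f" unfolding f_def
  proof (rule integrable_weighted)
    fix y :: "nat \<Rightarrow> real" assume y: "\<And>i. i < n \<Longrightarrow> \<bar>y i\<bar> \<le> 1"
    show "\<bar>resid i y * g y\<bar> \<le> 2 * K"
      unfolding abs_mult using y i by (intro mult_mono resid_bounded g) auto
  qed (use i in measurable)
  have inner: "(\<integral>z. f (y(i := z)) \<partial>\<mu>) = 0" for y
  proof -
    obtain c where c: "\<And>z. gibbs_weight n A h (y(i := z)) =
        c * exp (rest_field i y * z + A $$ (i, i) / 2 * z\<^sup>2)"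
      using gibbs_weight_update[OF i, of y] by blast
    have "(\<integral>z. f (y(i := z)) \<partial>\<mu>) = (\<integral>z. c * g y * (exp (rest_field i y * z + A $$ (i, i) / 2 * z\<^sup>2)
        * (z - site_mean \<mu> (rest_field i y) (A $$ (i, i)))) \<partial>\<mu>)"
      by (simp add: f_def c indep resid_def cond_mean_def rest_field_update mult_ac)
    also have "\<dots> = 0" using site_mean_centred by simp
    finally show ?thesis .
  qed
  have "integral\<^sup>L N f = (\<integral>y. (\<integral>z. f (y(i := z)) \<partial>\<mu>) \<partial>(\<Pi>\<^sub>M i\<in>{..<n} - {i}. \<mu>))"
    using base.product_integral_insert[of "{..<n} - {i}" i f] f unfolding ins by auto
  then show ?thesis
    using i by (subst gibbs_expectation) (simp_all add: inner f_def[symmetric])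
qed

lemma gibbs_mean_eq_cond_mean:
  assumes i: "i < n"
  shows "gibbs_mean n A \<mu> h i = (\<integral>y. cond_mean i y \<partial>G)"
proof -
  have "(\<integral>y. resid i y * 1 \<partial>G) = 0"
    by (rule resid_orthogonal[where K = 1]) (use i in auto)
  moreover have "integrable G (\<lambda>y. y i)" by (rule integrable_gibbs[where K = 1]) (use i in auto)
  moreover have "integrable G (cond_mean i)"
    by (rule integrable_gibbs[where K = 1]) (use i cond_mean_bounded in auto)
  ultimately show ?thesis by (simp add: gibbs_mean_def resid_def)
qed

lemma integrable_resid_mult:
  assumes "j < n" "k < n"
  shows "integrable G (\<lambda>y. resid j y * resid k y)"
proof (rule integrable_gibbs)
  fix y :: "nat \<Rightarrow> real" assume "\<And>i. i < n \<Longrightarrow> \<bar>y i\<bar> \<le> 1"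
  then show "\<bar>resid j y * resid k y\<bar> \<le> 2 * 2"
    unfolding abs_mult using assms by (intro mult_mono resid_bounded) auto
qed (use assms in measurable)

lemma gibbs_expectation_abs_le:
  assumes [measurable]: "f \<in> borel_measurable N"
    and f: "\<And>y. (\<And>i. i < n \<Longrightarrow> \<bar>y i\<bar> \<le> 1) \<Longrightarrow> \<bar>f y\<bar> \<le> (K :: real)"
  shows "\<bar>\<integral>y. f y \<partial>G\<bar> \<le> K"
proof -
  have "\<bar>\<integral>y. f y \<partial>G\<bar> \<le> (\<integral>y. \<bar>f y\<bar> \<partial>G)" by (rule integral_abs_bound)
  also have "\<dots> \<le> (\<integral>y. K \<partial>G)"
  proof (rule integral_mono_AE)
    show "AE y in G. \<bar>f y\<bar> \<le> K" using AE_gibbs_cube by eventually_elim (use f in auto)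
    show "integrable G (\<lambda>y. \<bar>f y\<bar>)" by (intro integrable_abs integrable_gibbs[OF assms(1) f])
  qed auto
  finally show ?thesis by (simp add: gibbs.prob_space)
qed

text \<open>
  Removing the term \<open>A\<^sub>k\<^sub>j y\<^sub>j\<close> from the field at \<open>k\<close> turns \<open>resid k\<close> into a function \<open>g\<close> that does not
  see \<open>y\<^sub>j\<close>, hence is orthogonal to \<open>resid j\<close>; by the Lipschitz bound this changes \<open>resid k\<close> by at
  most \<open>4 \<bar>A\<^sub>k\<^sub>j\<bar>\<close>.
\<close>

lemma resid_covariance_le:
  assumes j: "j < n" and k: "k < n" and jk: "j \<noteq> k"
  shows "\<bar>\<integral>y. resid j y * resid k y \<partial>G\<bar> \<le> 8 * \<bar>A $$ (j, k)\<bar>"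
proof -
  define g where "g = (\<lambda>y. y k - site_mean \<mu> (rest_field k y - A $$ (k, j) * y j) (A $$ (k, k)))"
  have [measurable]: "g \<in> borel_measurable N" unfolding g_def using j k by measurable
  have g2: "\<bar>g y\<bar> \<le> 2" if "\<And>i. i < n \<Longrightarrow> \<bar>y i\<bar> \<le> 1" for y
    using that[OF k] site_mean_bounded[of "rest_field k y - A $$ (k, j) * y j" "A $$ (k, k)"]
    unfolding g_def by linarith
  have "g (y(j := z)) = g y" for y z
    using j jk unfolding g_def by (simp add: rest_field_split cong: sum.cong_simp)
  then have orth: "(\<integral>y. resid j y * g y \<partial>G) = 0"
    by (intro resid_orthogonal[where K = 2] j g2) auto
  have int: "integrable G (\<lambda>y. resid j y * g y)"
  proof (rule integrable_gibbs)
    fix y :: "nat \<Rightarrow> real" assume "\<And>i. i < n \<Longrightarrow> \<bar>y i\<bar> \<le> 1"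
    then show "\<bar>resid j y * g y\<bar> \<le> 2 * 2"
      unfolding abs_mult using j by (intro mult_mono resid_bounded g2) auto
  qed (use j in measurable)
  have "(\<integral>y. resid j y * resid k y \<partial>G) = (\<integral>y. resid j y * (resid k y - g y) \<partial>G)"
    using orth int integrable_resid_mult[OF j k] by (simp add: right_diff_distrib)
  also have "\<bar>\<dots>\<bar> \<le> 2 * (4 * \<bar>A $$ (j, k)\<bar>)"
  proof (rule gibbs_expectation_abs_le)
    fix y :: "nat \<Rightarrow> real" assume y: "\<And>i. i < n \<Longrightarrow> \<bar>y i\<bar> \<le> 1"
    have "\<bar>resid k y - g y\<bar> \<le> 4 * \<bar>A $$ (k, j) * y j\<bar>"
      using site_mean_lipschitz[of "rest_field k y - A $$ (k, j) * y j" "A $$ (k, k)"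
          "rest_field k y" "A $$ (k, k)"]
      by (simp add: resid_def g_def cond_mean_def)
    also have "\<bar>A $$ (k, j) * y j\<bar> \<le> \<bar>A $$ (j, k)\<bar>"
      using y[OF j] A_sym[OF j k] by (simp add: abs_mult mult_left_le)
    finally show "\<bar>resid j y * (resid k y - g y)\<bar> \<le> 2 * (4 * \<bar>A $$ (j, k)\<bar>)"
      unfolding abs_mult using j y by (intro mult_mono resid_bounded) auto
  qed (use j k in measurable)
  finally show ?thesis by simp
qed

abbreviation resid_field :: "(nat \<Rightarrow> real) \<Rightarrow> nat \<Rightarrow> real" where
  "resid_field y \<equiv> mat_apply A (\<lambda>j. resid j y)"

text \<open>
  In \<open>\<Sum>\<^sub>j\<^sub>k (A\<^sup>2)\<^sub>j\<^sub>k E \<xi>\<^sub>j \<xi>\<^sub>k\<close> the diagonal is at most \<open>4 Tr A\<^sup>2\<close>, and off the diagonal the covariance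
  bound and \<open>2 a b \<le> a\<^sup>2 + b\<^sup>2\<close> leave the sum of squares of the entries of \<open>A\<^sup>2\<close> and of \<open>A\<close>.
\<close>

lemma resid_field_second_moment:
  assumes op: "op_norm A \<le> 1/8"
  shows "(\<integral>y. (L2_set (resid_field y) {..<n})\<^sup>2 \<partial>G) \<le> 9 * frob_sq n A"
proof -
  define B where "B = (\<lambda>j k. \<Sum>i<n. A $$ (i, j) * A $$ (i, k))"
  define E where "E = (\<lambda>j k. \<integral>y. resid j y * resid k y \<partial>G)"
  have expand: "(L2_set (resid_field y) {..<n})\<^sup>2 = (\<Sum>j<n. \<Sum>k<n. B j k * (resid j y * resid k y))" for y
  proof -
    have "(L2_set (resid_field y) {..<n})\<^sup>2 =
        (\<Sum>i<n. (\<Sum>j<n. A $$ (i, j) * resid j y) * (\<Sum>k<n. A $$ (i, k) * resid k y))"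
      unfolding L2_set_def mat_apply_eq
      by (subst real_sqrt_pow2) (auto intro!: sum_nonneg simp: power2_eq_square)
    also have "\<dots> = (\<Sum>i<n. \<Sum>j<n. \<Sum>k<n. A $$ (i, j) * A $$ (i, k) * (resid j y * resid k y))"
      unfolding sum_product by (intro sum.cong refl) simp
    also have "\<dots> = (\<Sum>j<n. \<Sum>i<n. \<Sum>k<n. A $$ (i, j) * A $$ (i, k) * (resid j y * resid k y))"
      by (rule sum.swap)
    also have "\<dots> = (\<Sum>j<n. \<Sum>k<n. \<Sum>i<n. A $$ (i, j) * A $$ (i, k) * (resid j y * resid k y))"
      by (intro sum.cong refl sum.swap)
    also have "\<dots> = (\<Sum>j<n. \<Sum>k<n. B j k * (resid j y * resid k y))"
      by (simp add: B_def sum_distrib_right)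
    finally show ?thesis .
  qed
  have "(\<integral>y. (L2_set (resid_field y) {..<n})\<^sup>2 \<partial>G) = (\<Sum>j<n. \<Sum>k<n. B j k * E j k)"
  proof -
    have "(\<integral>y. (\<Sum>j<n. \<Sum>k<n. B j k * (resid j y * resid k y)) \<partial>G)
        = (\<Sum>j<n. \<integral>y. (\<Sum>k<n. B j k * (resid j y * resid k y)) \<partial>G)"
      by (intro Bochner_Integration.integral_sum Bochner_Integration.integrable_sum
          integrable_mult_right integrable_resid_mult) auto
    also have "\<dots> = (\<Sum>j<n. \<Sum>k<n. \<integral>y. B j k * (resid j y * resid k y) \<partial>G)"
      by (intro sum.cong refl Bochner_Integration.integral_sum
          integrable_mult_right integrable_resid_mult) auto
    finally show ?thesis unfolding expand E_def by simp
  qed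
  also have "\<dots> \<le> (\<Sum>j<n. \<Sum>k<n. (if j = k then 4 * B j j else 0) + 4 * ((B j k)\<^sup>2 + (A $$ (j, k))\<^sup>2))"
  proof (intro sum_mono)
    fix j k assume "j \<in> {..<n}" "k \<in> {..<n}"
    then have j: "j < n" and k: "k < n" by auto
    show "B j k * E j k \<le> (if j = k then 4 * B j j else 0) + 4 * ((B j k)\<^sup>2 + (A $$ (j, k))\<^sup>2)"
    proof (cases "j = k")
      case True
      have "\<bar>E j j\<bar> \<le> 2 * 2" unfolding E_def
      proof (rule gibbs_expectation_abs_le)
        fix y :: "nat \<Rightarrow> real" assume "\<And>i. i < n \<Longrightarrow> \<bar>y i\<bar> \<le> 1"
        then show "\<bar>resid j y * resid j y\<bar> \<le> 2 * 2"
          unfolding abs_mult using j by (intro mult_mono resid_bounded) auto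
      qed (use j in measurable)
      moreover have "0 \<le> B j j" by (auto simp: B_def intro!: sum_nonneg)
      ultimately have "B j j * E j j \<le> B j j * 4" by (intro mult_left_mono) auto
      moreover have "0 \<le> 4 * ((B j j)\<^sup>2 + (A $$ (j, j))\<^sup>2)" by simp
      ultimately have "B j j * E j j + 0 \<le> B j j * 4 + 4 * ((B j j)\<^sup>2 + (A $$ (j, j))\<^sup>2)"
        by (rule add_mono)
      then show ?thesis using True by (simp only: if_True refl mult.commute[of 4 "B k k"] add_0_right)
    next
      case False
      have "\<bar>E j k\<bar> \<le> 8 * \<bar>A $$ (j, k)\<bar>" unfolding E_def by (rule resid_covariance_le[OF j k False])
      then have "\<bar>B j k\<bar> * \<bar>E j k\<bar> \<le> \<bar>B j k\<bar> * (8 * \<bar>A $$ (j, k)\<bar>)" by (intro mult_left_mono) auto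
      then have "B j k * E j k \<le> \<bar>B j k\<bar> * (8 * \<bar>A $$ (j, k)\<bar>)"
        using abs_ge_self[of "B j k * E j k"] by (simp add: abs_mult)
      also have "\<dots> \<le> 4 * ((B j k)\<^sup>2 + (A $$ (j, k))\<^sup>2)"
        using sum_squares_bound[of "\<bar>B j k\<bar>" "\<bar>A $$ (j, k)\<bar>"] by simp
      finally show ?thesis using False by simp
    qed
  qed
  also have "\<dots> = 4 * (\<Sum>j<n. B j j) + 4 * ((\<Sum>j<n. \<Sum>k<n. (B j k)\<^sup>2) + frob_sq n A)"
    by (simp add: sum.distrib sum_distrib_left[symmetric] frob_sq_def)
  also have "(\<Sum>j<n. B j j) = frob_sq n A"
    unfolding B_def frob_sq_def power2_eq_square by (rule sum.swap)
  also have "4 * frob_sq n A + 4 * ((\<Sum>j<n. \<Sum>k<n. (B j k)\<^sup>2) + frob_sq n A) \<le> 9 * frob_sq n A"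
  proof -
    have "(op_norm A)\<^sup>2 \<le> (1/8)\<^sup>2"
      by (intro power_mono op op_norm_nonneg[OF carrier])
    then have "(op_norm A)\<^sup>2 * frob_sq n A \<le> (1/8)\<^sup>2 * frob_sq n A"
      by (intro mult_right_mono frob_sq_nonneg)
    then have "(\<Sum>j<n. \<Sum>k<n. (B j k)\<^sup>2) \<le> (1/8)\<^sup>2 * frob_sq n A"
      using gram_sum_squares_le[OF carrier sym] unfolding B_def by linarith
    then show ?thesis using frob_sq_nonneg[of n A] by (simp add: power2_eq_square)
  qed
  finally show ?thesis .
qed

lemma measurable_L2_resid_field [measurable]:
  "(\<lambda>y. L2_set (resid_field y) {..<n}) \<in> borel_measurable N"
  unfolding L2_set_def mat_apply_eq by measurable

lemma L2_resid_field_bounded: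
  assumes "\<And>i. i < n \<Longrightarrow> \<bar>y i\<bar> \<le> 1"
  shows "\<bar>L2_set (resid_field y) {..<n}\<bar> \<le> op_norm A * L2_set (\<lambda>_. 2) {..<n}"
proof -
  have "L2_set (resid_field y) {..<n} \<le> op_norm A * L2_set (\<lambda>j. resid j y) {..<n}"
    by (rule L2_set_mat_apply_le[OF carrier])
  also have "\<dots> \<le> op_norm A * L2_set (\<lambda>_. 2) {..<n}"
    by (intro mult_left_mono L2_set_mono_abs resid_bounded op_norm_nonneg[OF carrier])
      (use assms in auto)
  finally show ?thesis by (simp add: L2_set_nonneg)
qed

lemma integrable_L2_resid_field: "integrable G (\<lambda>y. L2_set (resid_field y) {..<n})"
  by (rule integrable_gibbs[OF _ L2_resid_field_bounded]) auto

lemma resid_field_mean_norm: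
  assumes op: "op_norm A \<le> 1/8"
  shows "(\<integral>y. L2_set (resid_field y) {..<n} \<partial>G) \<le> 3 * sqrt (frob_sq n A)"
proof -
  define X where "X = (\<lambda>y. L2_set (resid_field y) {..<n})"
  have "integrable G (\<lambda>y. (X y)\<^sup>2)"
  proof (rule integrable_gibbs)
    fix y :: "nat \<Rightarrow> real" assume "\<And>i. i < n \<Longrightarrow> \<bar>y i\<bar> \<le> 1"
    then have "\<bar>X y\<bar>\<^sup>2 \<le> (op_norm A * L2_set (\<lambda>_. 2) {..<n})\<^sup>2"
      unfolding X_def by (intro power_mono L2_resid_field_bounded) auto
    then show "\<bar>(X y)\<^sup>2\<bar> \<le> (op_norm A * L2_set (\<lambda>_. 2) {..<n})\<^sup>2" by simp
  qed (simp add: X_def)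
  then have "(gibbs.expectation X)\<^sup>2 \<le> gibbs.expectation (\<lambda>y. (X y)\<^sup>2)"
    using gibbs.variance_eq[of X] gibbs.variance_positive[of X] integrable_L2_resid_field
    by (simp add: X_def)
  also have "\<dots> \<le> 9 * frob_sq n A"
    unfolding X_def by (rule resid_field_second_moment[OF op])
  finally have "gibbs.expectation X \<le> sqrt (9 * frob_sq n A)" by (rule real_le_rsqrt)
  then show ?thesis by (simp add: X_def real_sqrt_mult)
qed

section \<open>Distance to the mean-field iterates\<close>

text \<open>
  Since \<open>y = c + \<xi>\<close>, the fields at \<open>c\<close> and at the iterate \<open>u\<close> differ by
  \<open>A (c - u) + A \<xi> - diag(A) y\<close>. So \<open>e\<^sub>M = \<parallel>c - u\<^sup>M\<parallel>\<close> satisfies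
  \<open>e\<^sub>M\<^sub>+\<^sub>1 \<le> e\<^sub>M / 2 + 4 \<parallel>A \<xi>\<parallel> + 6 \<parallel>A\<parallel>\<^sub>F\<close>, and the last two terms sum over the iterations to at
  most twice their value.
\<close>

lemma mf_iter_cond_mean:
  assumes op: "op_norm A \<le> 1/8" and y: "\<And>i. i < n \<Longrightarrow> \<bar>y i\<bar> \<le> 1"
  shows "L2_set (\<lambda>i. cond_mean i y - mf_iter A \<mu> h M i) {..<n}
    \<le> (1/2) ^ M * sqrt (real n) + 12 * sqrt (frob_sq n A) + 8 * L2_set (resid_field y) {..<n}"
proof (induction M)
  case 0
  have "L2_set (\<lambda>i. cond_mean i y) {..<n} \<le> L2_set (\<lambda>_. 1) {..<n}"
    by (intro L2_set_mono_abs cond_mean_bounded)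
  also have "\<dots> = sqrt (real n)" by (simp add: L2_set_def)
  moreover have "0 \<le> 12 * sqrt (frob_sq n A) + 8 * L2_set (resid_field y) {..<n}"
    by (simp add: frob_sq_nonneg)
  ultimately show ?case by simp
next
  case (Suc M)
  define w where "w = (\<lambda>i. cond_mean i y - mf_iter A \<mu> h M i)"
  have pointwise: "\<bar>cond_mean i y - mf_iter A \<mu> h (Suc M) i\<bar>
      \<le> 4 * \<bar>mat_apply A w i\<bar> + (4 * \<bar>resid_field y i\<bar> + 6 * \<bar>A $$ (i, i)\<bar>)" if i: "i \<in> {..<n}" for i
  proof -
    have rest: "rest_field i y = mat_apply A y i - A $$ (i, i) * y i + h i"
      unfolding rest_field_def mat_apply_eq using i by (subst sum.remove[of "{..<n}" i]) auto
    have "mat_apply A y i = mat_apply A w i + resid_field y i + mat_apply A (mf_iter A \<mu> h M) i"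
      by (simp add: mat_apply_eq w_def resid_def algebra_simps flip: sum.distrib)
    then have "rest_field i y - (mat_apply A (mf_iter A \<mu> h M) i + h i) =
        mat_apply A w i + resid_field y i - A $$ (i, i) * y i"
      using rest by linarith
    moreover have "\<bar>A $$ (i, i) * y i\<bar> \<le> \<bar>A $$ (i, i)\<bar>"
      using y i by (simp add: abs_mult mult_left_le)
    moreover have "\<bar>mat_apply A w i + resid_field y i - A $$ (i, i) * y i\<bar>
        \<le> \<bar>mat_apply A w i\<bar> + \<bar>resid_field y i\<bar> + \<bar>A $$ (i, i) * y i\<bar>"
      by (rule order_trans[OF abs_triangle_ineq4 add_right_mono[OF abs_triangle_ineq]])
    ultimately have field: "\<bar>rest_field i y - (mat_apply A (mf_iter A \<mu> h M) i + h i)\<bar>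
        \<le> \<bar>mat_apply A w i\<bar> + \<bar>resid_field y i\<bar> + \<bar>A $$ (i, i)\<bar>"
      by simp
    have "\<bar>cond_mean i y - mf_iter A \<mu> h (Suc M) i\<bar>
        \<le> 4 * (\<bar>rest_field i y - (mat_apply A (mf_iter A \<mu> h M) i + h i)\<bar> + \<bar>A $$ (i, i) - 0\<bar> / 2)"
      unfolding cond_mean_def mf_iter.simps alpha'_eq_site_mean by (rule site_mean_lipschitz)
    also have "\<dots> \<le> 4 * (\<bar>mat_apply A w i\<bar> + \<bar>resid_field y i\<bar> + \<bar>A $$ (i, i)\<bar> + \<bar>A $$ (i, i) - 0\<bar> / 2)"
      by (intro mult_left_mono add_right_mono field) simp
    also have "\<dots> = 4 * \<bar>mat_apply A w i\<bar> + (4 * \<bar>resid_field y i\<bar> + 6 * \<bar>A $$ (i, i)\<bar>)" by simp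
    finally show ?thesis .
  qed
  have "L2_set (\<lambda>i. cond_mean i y - mf_iter A \<mu> h (Suc M) i) {..<n}
      \<le> L2_set (\<lambda>i. 4 * \<bar>mat_apply A w i\<bar> + (4 * \<bar>resid_field y i\<bar> + 6 * \<bar>A $$ (i, i)\<bar>)) {..<n}"
    by (rule L2_set_mono_abs) (rule pointwise)
  also have "\<dots> \<le> L2_set (\<lambda>i. 4 * \<bar>mat_apply A w i\<bar>) {..<n}
      + (L2_set (\<lambda>i. 4 * \<bar>resid_field y i\<bar>) {..<n} + L2_set (\<lambda>i. 6 * \<bar>A $$ (i, i)\<bar>) {..<n})"
    by (rule order_trans[OF L2_set_triangle_ineq]) (intro add_left_mono L2_set_triangle_ineq)
  also have "\<dots> = 4 * L2_set (mat_apply A w) {..<n}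
      + (4 * L2_set (resid_field y) {..<n} + 6 * L2_set (\<lambda>i. A $$ (i, i)) {..<n})"
    by (simp add: L2_set_right_distrib[symmetric] L2_set_abs_eq)
  also have "\<dots> \<le> 4 * (1/8 * L2_set w {..<n})
      + (4 * L2_set (resid_field y) {..<n} + 6 * sqrt (frob_sq n A))"
  proof -
    have "L2_set (mat_apply A w) {..<n} \<le> op_norm A * L2_set w {..<n}"
      by (rule L2_set_mat_apply_le[OF carrier])
    also have "\<dots> \<le> 1/8 * L2_set w {..<n}" by (intro mult_right_mono op) auto
    finally show ?thesis using diagonal_L2_le[of A n] by linarith
  qed
  finally show ?case using Suc unfolding w_def by simp
qed

text \<open>
  Take expectations in \<open>mf_iter_cond_mean\<close> after passing from the \<open>L\<^sup>1\<close> to the \<open>L\<^sup>2\<close> norm by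
  Cauchy-Schwarz.
\<close>

lemma gibbs_mean_near_mf_iter:
  assumes op: "op_norm A \<le> 1/8"
  shows "(\<Sum>i<n. \<bar>mf_iter A \<mu> h M i - gibbs_mean n A \<mu> h i\<bar>)
    \<le> real n * (1/2) ^ M + 36 * sqrt (real n * frob_sq n A)"
proof -
  define u where "u = mf_iter A \<mu> h M"
  have int: "integrable G (\<lambda>y. \<bar>u i - cond_mean i y\<bar>)" if i: "i < n" for i
  proof (rule integrable_gibbs)
    show "\<bar>\<bar>u i - cond_mean i y\<bar>\<bar> \<le> \<bar>u i\<bar> + 1" for y
      using cond_mean_bounded[of i y] by linarith
  qed (use i in measurable)
  have "(\<Sum>i<n. \<bar>u i - gibbs_mean n A \<mu> h i\<bar>) \<le> (\<Sum>i<n. \<integral>y. \<bar>u i - cond_mean i y\<bar> \<partial>G)"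
  proof (rule sum_mono)
    fix i assume "i \<in> {..<n}"
    then have i: "i < n" by simp
    have "integrable G (cond_mean i)"
      by (rule integrable_gibbs[where K = 1]) (use i cond_mean_bounded in auto)
    then have "u i - gibbs_mean n A \<mu> h i = (\<integral>y. u i - cond_mean i y \<partial>G)"
      by (simp add: gibbs_mean_eq_cond_mean[OF i] gibbs.prob_space)
    then show "\<bar>u i - gibbs_mean n A \<mu> h i\<bar> \<le> (\<integral>y. \<bar>u i - cond_mean i y\<bar> \<partial>G)"
      by (simp add: integral_abs_bound)
  qed
  also have "\<dots> = (\<integral>y. (\<Sum>i<n. \<bar>u i - cond_mean i y\<bar>) \<partial>G)"
    using int by (subst Bochner_Integration.integral_sum) auto
  also have "\<dots> \<le> (\<integral>y. sqrt (real n) * ((1/2) ^ M * sqrt (real n) + 12 * sqrt (frob_sq n A)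
      + 8 * L2_set (resid_field y) {..<n}) \<partial>G)"
  proof (rule integral_mono_AE)
    show "AE y in G. (\<Sum>i<n. \<bar>u i - cond_mean i y\<bar>) \<le> sqrt (real n) * ((1/2) ^ M * sqrt (real n)
        + 12 * sqrt (frob_sq n A) + 8 * L2_set (resid_field y) {..<n})"
      using AE_gibbs_cube
    proof eventually_elim
      case (elim y)
      have "(\<Sum>i<n. \<bar>u i - cond_mean i y\<bar>) = (\<Sum>i<n. \<bar>1\<bar> * \<bar>cond_mean i y - u i\<bar>)"
        by (simp add: abs_minus_commute)
      also have "\<dots> \<le> L2_set (\<lambda>_. 1) {..<n} * L2_set (\<lambda>i. cond_mean i y - u i) {..<n}"
        by (rule L2_set_mult_ineq)
      also have "\<dots> \<le> sqrt (real n) * ((1/2) ^ M * sqrt (real n) + 12 * sqrt (frob_sq n A)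
          + 8 * L2_set (resid_field y) {..<n})"
        unfolding u_def by (intro mult_mono mf_iter_cond_mean op) (use elim in \<open>auto simp: L2_set_def intro!: sum_nonneg add_nonneg_nonneg frob_sq_nonneg\<close>)
      finally show ?case .
    qed
  qed (use int integrable_L2_resid_field in \<open>auto simp del: distrib_left_numeral
        intro!: Bochner_Integration.integrable_sum integrable_mult_right Bochner_Integration.integrable_add\<close>)
  also have "\<dots> = sqrt (real n) * ((1/2) ^ M * sqrt (real n) + 12 * sqrt (frob_sq n A)
      + 8 * (\<integral>y. L2_set (resid_field y) {..<n} \<partial>G))"
    using integrable_L2_resid_field by (simp add: gibbs.prob_space)
  also have "\<dots> \<le> sqrt (real n) * ((1/2) ^ M * sqrt (real n) + 12 * sqrt (frob_sq n A)
      + 8 * (3 * sqrt (frob_sq n A)))"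
    by (intro mult_left_mono add_left_mono resid_field_mean_norm op) auto
  also have "\<dots> = real n * (1/2) ^ M + 36 * sqrt (real n * frob_sq n A)"
    by (simp add: algebra_simps real_sqrt_mult flip: power2_eq_square)
  finally show ?thesis by (simp add: u_def)
qed

end

section \<open>Averages over sign vectors\<close>

lemma finite_sign_vectors: "finite I \<Longrightarrow> finite (sign_vectors I)"
  unfolding sign_vectors_def by (rule finite_PiE) auto

lemma card_sign_vectors: "finite I \<Longrightarrow> card (sign_vectors I) = 2 ^ card I"
  by (simp add: sign_vectors_def card_PiE numeral_2_eq_2)

lemma sign_vectors_abs: "t \<in> sign_vectors I \<Longrightarrow> i \<in> I \<Longrightarrow> \<bar>t i\<bar> = 1"
  by (auto simp: sign_vectors_def PiE_def Pi_def)

lemma sum_sign_vectors_split: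
  fixes f :: "(nat \<Rightarrow> real) \<Rightarrow> 'a::comm_monoid_add"
  assumes I: "finite I" "i \<in> I"
  shows "(\<Sum>t\<in>sign_vectors I. f t) = (\<Sum>t\<in>sign_vectors (I - {i}). f (t(i := 1)) + f (t(i := -1)))"
proof -
  define J where "J = I - {i}"
  have J: "I = insert i J" "i \<notin> J" "finite J" using I by (auto simp: J_def)
  have inj: "inj_on (\<lambda>(s, t). t(i := s)) ({-1, 1} \<times> sign_vectors J)"
    using inj_combinator[OF J(2), of "\<lambda>_. {-1, 1}"] by (simp add: sign_vectors_def)
  have "(\<Sum>t\<in>sign_vectors I. f t) = (\<Sum>t\<in>(\<lambda>(s, t). t(i := s)) ` ({-1, 1} \<times> sign_vectors J). f t)"
    unfolding sign_vectors_def J(1) PiE_insert_eq ..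
  also have "\<dots> = (\<Sum>p\<in>{-1, 1} \<times> sign_vectors J. f ((snd p)(i := fst p)))"
    by (subst sum.reindex[OF inj]) (simp add: case_prod_unfold)
  also have "\<dots> = (\<Sum>s\<in>{-1, 1}. \<Sum>t\<in>sign_vectors J. f (t(i := s)))"
    by (subst sum.cartesian_product) (simp add: case_prod_unfold)
  also have "\<dots> = (\<Sum>t\<in>sign_vectors J. f (t(i := 1)) + f (t(i := -1)))"
    by (simp add: sum.distrib add.commute)
  finally show ?thesis by (simp add: J_def)
qed

definition sign_avg :: "nat \<Rightarrow> ((nat \<Rightarrow> real) \<Rightarrow> real) \<Rightarrow> real" where
  "sign_avg n F = (1/2) ^ n * (\<Sum>t\<in>sign_vectors {..<n}. F t)"

lemma sign_avg_const [simp]: "sign_avg n (\<lambda>_. c) = c"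
  by (simp add: sign_avg_def card_sign_vectors power_one_over)

lemma sign_avg_diff: "sign_avg n (\<lambda>t. F t - F' t) = sign_avg n F - sign_avg n F'"
  by (simp add: sign_avg_def sum_subtractf right_diff_distrib)

lemma sign_avg_cmult: "sign_avg n (\<lambda>t. c * F t) = c * sign_avg n F"
  by (simp add: sign_avg_def sum_distrib_left[symmetric])

lemma sign_avg_sum: "sign_avg n (\<lambda>t. \<Sum>i\<in>I. F i t) = (\<Sum>i\<in>I. sign_avg n (F i))"
  unfolding sign_avg_def by (subst sum.swap) (simp add: sum_distrib_left)

lemma sign_avg_diff_le:
  assumes "\<And>t. t \<in> sign_vectors {..<n} \<Longrightarrow> \<bar>F t - F' t\<bar> \<le> K"
  shows "\<bar>sign_avg n F - sign_avg n F'\<bar> \<le> K"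
proof -
  have "\<bar>sign_avg n F - sign_avg n F'\<bar> = (1/2) ^ n * \<bar>\<Sum>t\<in>sign_vectors {..<n}. F t - F' t\<bar>"
    unfolding sign_avg_diff[symmetric] by (simp add: sign_avg_def abs_mult)
  also have "\<dots> \<le> (1/2) ^ n * (\<Sum>t\<in>sign_vectors {..<n}. K)"
    by (intro mult_left_mono order_trans[OF sum_abs] sum_mono assms) auto
  also have "\<dots> = K" using sign_avg_const[of n K] by (simp only: sign_avg_def)
  finally show ?thesis .
qed

text \<open>
  Conditioning on the signs other than the \<open>i\<close>-th. Applied to \<open>T\<^sub>i F(T)\<close> it produces the difference of
  the two treatments of unit \<open>i\<close>, which is how the effects become plain expectations.
\<close>

lemma sign_avg_split:
  assumes i: "i < n"
  shows "(\<Sum>t\<in>sign_vectors ({..<n} - {i}). (1/2) ^ (n - 1) * (F (t(i := 1)) + F (t(i := -1))))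
    = 2 * sign_avg n F"
proof -
  have "(1/2 :: real) ^ (n - 1) = 2 * (1/2) ^ n" using i by (cases n) auto
  then show ?thesis
    using i by (simp add: sign_avg_def sum_sign_vectors_split[of "{..<n}" i] sum_distrib_left mult_ac)
qed

text \<open>
  The functionals by which the algorithm forms its two estimates from the spin means \<open>b t i\<close> under
  treatment \<open>t\<close>; applied to the exact means they yield the two effects.
\<close>

definition direct_contrast :: "nat \<Rightarrow> ((nat \<Rightarrow> real) \<Rightarrow> nat \<Rightarrow> real) \<Rightarrow> (nat \<Rightarrow> real) \<Rightarrow> real" where
  "direct_contrast n b t = 2 / real n * (\<Sum>i<n. t i * b t i)"

definition indirect_contrast :: "nat \<Rightarrow> ((nat \<Rightarrow> real) \<Rightarrow> nat \<Rightarrow> real) \<Rightarrow> (nat \<Rightarrow> real) \<Rightarrow> real" where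
  "indirect_contrast n b t =
    1 / real n * ((\<Sum>i<n. b t i) - (\<Sum>i<n. b (\<lambda>_. -1) i)) - 1/2 * direct_contrast n b t"

lemma direct_contrast_diff_le:
  assumes t: "t \<in> sign_vectors {..<n}" and ab: "(\<Sum>i<n. \<bar>a t i - b t i\<bar>) \<le> D"
  shows "\<bar>direct_contrast n a t - direct_contrast n b t\<bar> \<le> 2 / real n * D"
proof -
  have "direct_contrast n a t - direct_contrast n b t = 2 / real n * (\<Sum>i<n. t i * (a t i - b t i))"
    by (simp add: direct_contrast_def sum_subtractf right_diff_distrib)
  also have "\<bar>\<dots>\<bar> = 2 / real n * \<bar>\<Sum>i<n. t i * (a t i - b t i)\<bar>" by (simp add: abs_mult)
  also have "\<dots> \<le> 2 / real n * (\<Sum>i<n. \<bar>t i * (a t i - b t i)\<bar>)" by (intro mult_left_mono sum_abs) auto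
  also have "\<dots> = 2 / real n * (\<Sum>i<n. \<bar>a t i - b t i\<bar>)"
    using sign_vectors_abs[OF t] by (simp add: abs_mult)
  also have "\<dots> \<le> 2 / real n * D" by (intro mult_left_mono ab) auto
  finally show ?thesis .
qed

lemma indirect_contrast_diff_le:
  assumes t: "t \<in> sign_vectors {..<n}" and ab: "\<And>t. (\<Sum>i<n. \<bar>a t i - b t i\<bar>) \<le> D"
  shows "\<bar>indirect_contrast n a t - indirect_contrast n b t\<bar> \<le> 3 / real n * D"
proof -
  have diff: "\<bar>1 / real n * ((\<Sum>i<n. a s i) - (\<Sum>i<n. b s i))\<bar> \<le> 1 / real n * D" for s
  proof -
    have "\<bar>(\<Sum>i<n. a s i) - (\<Sum>i<n. b s i)\<bar> \<le> (\<Sum>i<n. \<bar>a s i - b s i\<bar>)"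
      unfolding sum_subtractf[symmetric] by (rule sum_abs)
    also have "\<dots> \<le> D" by (rule ab)
    finally show ?thesis unfolding abs_mult by (intro mult_mono) auto
  qed
  have direct: "\<bar>direct_contrast n a t - direct_contrast n b t\<bar> \<le> 2 * (1 / real n * D)"
    using direct_contrast_diff_le[where a = a and b = b, OF t ab[of t]] by simp
  have combine: "\<bar>x - y - 1/2 * z\<bar> \<le> 3 * e"
    if "\<bar>x\<bar> \<le> e" "\<bar>y\<bar> \<le> e" "\<bar>z\<bar> \<le> 2 * e" for x y z e :: real
    using that by linarith
  have "indirect_contrast n a t - indirect_contrast n b t =
      1 / real n * ((\<Sum>i<n. a t i) - (\<Sum>i<n. b t i))
      - 1 / real n * ((\<Sum>i<n. a (\<lambda>_. -1) i) - (\<Sum>i<n. b (\<lambda>_. -1) i))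
      - 1/2 * (direct_contrast n a t - direct_contrast n b t)"
    by (simp add: indirect_contrast_def right_diff_distrib)
  also have "\<bar>\<dots>\<bar> \<le> 3 * (1 / real n * D)"
    by (rule combine[OF diff diff direct])
  finally show ?thesis by simp
qed

section \<open>Causal effects as sign averages\<close>

locale effect_model = bounded_spin \<mu> for \<mu> :: "real measure" +
  fixes n :: nat and A :: "real mat" and P :: "(nat \<Rightarrow> real) measure"
    and d :: nat and \<tau> :: real and \<theta> :: "nat \<Rightarrow> real"
  assumes carrier: "A \<in> carrier_mat n n" and sym: "transpose_mat A = A" and n_pos: "0 < n"
    and prob_P: "prob_space P"
    and sets_P [measurable_cong]: "sets P = sets (\<Pi>\<^sub>M k\<in>{..<d}. (borel :: real measure))"
begin

abbreviation "Q \<equiv> iid_rows n P"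
abbreviation "efield t x \<equiv> ext_field d \<tau> \<theta> t x"

lemma model: "gibbs_model \<mu> n A"
  by unfold_locales (rule carrier sym)+

sublocale rows: prob_space Q
  unfolding iid_rows_def by (rule prob_space_PiM) (rule prob_P)

lemma measurable_field [measurable]:
  assumes "i < n"
  shows "(\<lambda>x. efield t x i) \<in> borel_measurable Q"
proof -
  have [measurable]: "(\<lambda>x. x i) \<in> measurable Q P"
    unfolding iid_rows_def using assms by (intro measurable_component_singleton) auto
  have [measurable]: "(\<lambda>z. z k) \<in> borel_measurable P" if "k < d" for k
    unfolding measurable_cong_sets[OF sets_P refl]
    using that by (intro measurable_component_singleton) auto
  show ?thesis unfolding ext_field_def by measurable
qed

lemma measurable_mf_iter:
  "i < n \<Longrightarrow> (\<lambda>x. mf_iter A \<mu> (efield t x) M i) \<in> borel_measurable Q"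
proof (induction M arbitrary: i)
  case (Suc M)
  note [measurable] = Suc.IH
  show ?case
    using Suc.prems unfolding mf_iter.simps alpha'_eq_site_mean mat_apply_eq_sum[OF carrier] by measurable
qed simp

lemma mf_iter_bounded: "\<bar>mf_iter A \<mu> h M i\<bar> \<le> 1"
  by (cases M) (auto simp: alpha'_eq_site_mean site_mean_bounded)

lemma gibbs_mean_bounded:
  assumes i: "i < n"
  shows "\<bar>gibbs_mean n A \<mu> h i\<bar> \<le> 1"
  unfolding gibbs_mean_def
  by (rule gibbs_model.gibbs_expectation_abs_le[OF model gibbs_model.measurable_coordinate[OF model i]])
    (use i in auto)

lemma measurable_gibbs_mean:
  assumes i: "i < n"
  shows "(\<lambda>x. gibbs_mean n A \<mu> (efield t x) i) \<in> borel_measurable Q"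
proof -
  define N where "N = (\<Pi>\<^sub>M i\<in>{..<n}. \<mu>)"
  have [measurable]: "(\<lambda>y. y j) \<in> borel_measurable N" if "j < n" for j
    unfolding N_def by (rule gibbs_model.measurable_coordinate[OF model that])
  have eq: "gibbs_mean n A \<mu> (efield t x) i = (\<integral>y. gibbs_weight n A (efield t x) y * y i \<partial>N)
      / (\<integral>y. gibbs_weight n A (efield t x) y \<partial>N)" for x
    unfolding gibbs_mean_def N_def
    by (subst gibbs_model.gibbs_expectation[OF model gibbs_model.measurable_coordinate[OF model i]])
      (simp add: gibbs_Z_def)
  interpret N: prob_space N
    unfolding N_def by (rule prob_space_PiM) (rule prob_space_axioms)
  have [measurable]: "(\<lambda>(x, y). gibbs_weight n A (efield t x) y) \<in> borel_measurable (Q \<Otimes>\<^sub>M N)"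
    unfolding gibbs_weight_def mat_apply_eq_sum[OF carrier] by measurable
  show ?thesis unfolding eq using i by measurable
qed

lemma integrable_rows:
  assumes "f \<in> borel_measurable Q" "\<And>x. \<bar>f x\<bar> \<le> (K :: real)"
  shows "integrable Q f"
  by (rule rows.integrable_const_bound[where B = K]) (use assms in auto)

lemma integrable_mf_iter: "i < n \<Longrightarrow> integrable Q (\<lambda>x. mf_iter A \<mu> (efield t x) M i)"
  by (intro integrable_rows[where K = 1] measurable_mf_iter mf_iter_bounded)

lemma integrable_gibbs_mean: "i < n \<Longrightarrow> integrable Q (\<lambda>x. gibbs_mean n A \<mu> (efield t x) i)"
  by (intro integrable_rows[where K = 1] measurable_gibbs_mean gibbs_mean_bounded)

definition exact_mean :: "(nat \<Rightarrow> real) \<Rightarrow> nat \<Rightarrow> real" where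
  "exact_mean t i = (\<integral>x. gibbs_mean n A \<mu> (efield t x) i \<partial>Q)"

definition mf_mean :: "nat \<Rightarrow> (nat \<Rightarrow> real) \<Rightarrow> nat \<Rightarrow> real" where
  "mf_mean M t i = (\<integral>x. mf_iter A \<mu> (efield t x) M i \<partial>Q)"

lemma mf_mean_near_exact_mean:
  assumes op: "op_norm A \<le> 1/8"
  shows "(\<Sum>i<n. \<bar>mf_mean M t i - exact_mean t i\<bar>)
    \<le> real n * (1/2) ^ M + 36 * sqrt (real n * frob_sq n A)"
proof -
  have int: "integrable Q (\<lambda>x. \<bar>mf_iter A \<mu> (efield t x) M i - gibbs_mean n A \<mu> (efield t x) i\<bar>)" if "i < n" for i
    using integrable_mf_iter[OF that] integrable_gibbs_mean[OF that] by simp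
  have "(\<Sum>i<n. \<bar>mf_mean M t i - exact_mean t i\<bar>)
      \<le> (\<Sum>i<n. \<integral>x. \<bar>mf_iter A \<mu> (efield t x) M i - gibbs_mean n A \<mu> (efield t x) i\<bar> \<partial>Q)"
  proof (rule sum_mono)
    fix i assume "i \<in> {..<n}"
    then have "mf_mean M t i - exact_mean t i
        = (\<integral>x. mf_iter A \<mu> (efield t x) M i - gibbs_mean n A \<mu> (efield t x) i \<partial>Q)"
      by (simp add: mf_mean_def exact_mean_def integrable_mf_iter integrable_gibbs_mean)
    then show "\<bar>mf_mean M t i - exact_mean t i\<bar>
        \<le> (\<integral>x. \<bar>mf_iter A \<mu> (efield t x) M i - gibbs_mean n A \<mu> (efield t x) i\<bar> \<partial>Q)"
      by (simp add: integral_abs_bound)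
  qed
  also have "\<dots> = (\<integral>x. (\<Sum>i<n. \<bar>mf_iter A \<mu> (efield t x) M i - gibbs_mean n A \<mu> (efield t x) i\<bar>) \<partial>Q)"
    using int by (intro Bochner_Integration.integral_sum[symmetric]) auto
  also have "\<dots> \<le> (\<integral>x. real n * (1/2) ^ M + 36 * sqrt (real n * frob_sq n A) \<partial>Q)"
    using int by (intro integral_mono gibbs_model.gibbs_mean_near_mf_iter[OF model op]
        Bochner_Integration.integrable_sum) auto
  also have "\<dots> = real n * (1/2) ^ M + 36 * sqrt (real n * frob_sq n A)" by (simp add: rows.prob_space)
  finally show ?thesis .
qed

text \<open>
  Fubini. The signs carry the discrete \<open>\<sigma>\<close>-algebra, so measurability of \<open>F\<close> in \<open>x\<close> for each fixed \<open>t\<close>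
  suffices.
\<close>

lemma expect_TX_eq_sign_avg:
  assumes F: "\<And>t. t \<in> sign_vectors {..<n} \<Longrightarrow> F t \<in> borel_measurable Q"
    and K: "\<And>t x. t \<in> sign_vectors {..<n} \<Longrightarrow> \<bar>F t x\<bar> \<le> K"
  shows "expect_TX n P F = sign_avg n (\<lambda>t. \<integral>x. F t x \<partial>Q)"
proof -
  let ?S = "sign_vectors {..<n}"
  let ?U = "uniform_count_measure ?S"
  have fin: "finite ?S" by (simp add: finite_sign_vectors)
  have ne: "?S \<noteq> {}" using card_sign_vectors[of "{..<n}"] by auto
  interpret U: prob_space ?U by (rule prob_space_uniform_count_measure[OF fin ne])
  interpret UQ: pair_prob_space ?U Q ..
  have "(\<lambda>(t, x). F t x) \<in> borel_measurable (count_space ?S \<Otimes>\<^sub>M Q)"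
    by (rule measurable_pair_measure_countable1) (use fin F in \<open>auto intro: countable_finite\<close>)
  also have "borel_measurable (count_space ?S \<Otimes>\<^sub>M Q) = borel_measurable (?U \<Otimes>\<^sub>M Q)"
    by (intro measurable_cong_sets sets_pair_measure_cong) (auto simp: sets_uniform_count_measure)
  finally have meas: "(\<lambda>(t, x). F t x) \<in> borel_measurable (?U \<Otimes>\<^sub>M Q)" .
  have "integrable (?U \<Otimes>\<^sub>M Q) (\<lambda>(t, x). F t x)"
  proof (rule UQ.integrable_const_bound[where B = K])
    show "AE p in ?U \<Otimes>\<^sub>M Q. norm (case p of (t, x) \<Rightarrow> F t x) \<le> K"
      by (rule AE_I2) (auto simp: space_pair_measure space_uniform_count_measure intro: K)
  qed (rule meas)
  from UQ.integral_fst'[OF this] have "expect_TX n P F = (\<integral>t. (\<integral>x. F t x \<partial>Q) \<partial>?U)"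
    by (simp add: expect_TX_def)
  also have "\<dots> = sign_avg n (\<lambda>t. \<integral>x. F t x \<partial>Q)"
    using fin by (simp add: integral_uniform_count_measure sign_avg_def card_sign_vectors power_one_over)
  finally show ?thesis .
qed

lemma DE_hat_integral:
  "(\<integral>x. DE_hat n A \<mu> d \<tau> \<theta> M t x \<partial>Q) = direct_contrast n (mf_mean M) t"
  unfolding DE_hat_def direct_contrast_def mf_mean_def
  by (simp add: integrable_mf_iter)

lemma integrable_DE_hat: "integrable Q (DE_hat n A \<mu> d \<tau> \<theta> M t)"
  unfolding DE_hat_def
  by (intro integrable_mult_right Bochner_Integration.integrable_sum integrable_mf_iter) auto

lemma DE_hat_bounded:
  assumes "t \<in> sign_vectors {..<n}"
  shows "\<bar>DE_hat n A \<mu> d \<tau> \<theta> M t x\<bar> \<le> 2"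
proof -
  have "\<bar>\<Sum>i<n. t i * mf_iter A \<mu> (efield t x) M i\<bar> \<le> (\<Sum>i<n. 1)"
    by (intro order_trans[OF sum_abs] sum_mono)
      (use assms mf_iter_bounded in \<open>auto simp: abs_mult sign_vectors_abs\<close>)
  then show ?thesis using n_pos by (simp add: DE_hat_def abs_mult divide_simps)
qed

lemma expect_DE_hat:
  "expect_TX n P (DE_hat n A \<mu> d \<tau> \<theta> M) = sign_avg n (direct_contrast n (mf_mean M))"
  by (subst expect_TX_eq_sign_avg[where K = 2])
    (auto simp: DE_hat_integral DE_hat_bounded intro: borel_measurable_integrable integrable_DE_hat)

lemma expect_IE_hat:
  "expect_TX n P (IE_hat n A \<mu> d \<tau> \<theta> M) = sign_avg n (indirect_contrast n (mf_mean M))"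
proof -
  have "\<bar>IE_hat n A \<mu> d \<tau> \<theta> M t x\<bar> \<le> 3" if t: "t \<in> sign_vectors {..<n}" for t x
  proof -
    have sum1: "\<bar>1 / real n * (\<Sum>i<n. mf_iter A \<mu> h M i)\<bar> \<le> 1" for h
    proof -
      have "\<bar>\<Sum>i<n. mf_iter A \<mu> h M i\<bar> \<le> (\<Sum>i<n. 1)"
        by (intro order_trans[OF sum_abs] sum_mono mf_iter_bounded)
      then show ?thesis using n_pos by (simp add: abs_mult divide_simps)
    qed
    show ?thesis
      unfolding IE_hat_def right_diff_distrib
      using sum1[of "efield t x"] sum1[of "efield (\<lambda>_. -1) x"] DE_hat_bounded[OF t, of M x] by linarith
  qed
  moreover have int: "integrable Q (IE_hat n A \<mu> d \<tau> \<theta> M t)" for t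
    unfolding IE_hat_def
    by (intro Bochner_Integration.integrable_diff integrable_mult_right
        Bochner_Integration.integrable_sum integrable_mf_iter integrable_DE_hat) auto
  moreover have "(\<integral>x. IE_hat n A \<mu> d \<tau> \<theta> M t x \<partial>Q) = indirect_contrast n (mf_mean M) t" for t
  proof -
    have int: "integrable Q (\<lambda>x. \<Sum>i<n. mf_iter A \<mu> (efield t x) M i)" for t
      by (intro Bochner_Integration.integrable_sum integrable_mf_iter) auto
    have sum: "(\<integral>x. (\<Sum>i<n. mf_iter A \<mu> (efield t x) M i) \<partial>Q) = (\<Sum>i<n. mf_mean M t i)" for t
      unfolding mf_mean_def by (intro Bochner_Integration.integral_sum integrable_mf_iter) auto
    show ?thesis
      unfolding IE_hat_def indirect_contrast_def DE_hat_integral[symmetric] sum[symmetric]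
      by (simp add: int integrable_DE_hat)
  qed
  ultimately show ?thesis
    by (subst expect_TX_eq_sign_avg[where K = 3]) (auto intro: borel_measurable_integrable)
qed

lemma direct_effect_eq: "direct_effect n A \<mu> d \<tau> \<theta> P = sign_avg n (direct_contrast n exact_mean)"
proof -
  have "direct_effect n A \<mu> d \<tau> \<theta> P = 1 / real n * (\<Sum>i<n. \<Sum>t\<in>sign_vectors ({..<n} - {i}).
      (1/2) ^ (n - 1) * (exact_mean (t(i := 1)) i - exact_mean (t(i := -1)) i))"
    unfolding direct_effect_def exact_mean_def by (simp add: integrable_gibbs_mean)
  also have "\<dots> = 1 / real n * (\<Sum>i<n. 2 * sign_avg n (\<lambda>t. t i * exact_mean t i))"
  proof -
    have "(\<Sum>t\<in>sign_vectors ({..<n} - {i}).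
        (1/2) ^ (n - 1) * (exact_mean (t(i := 1)) i - exact_mean (t(i := -1)) i))
        = 2 * sign_avg n (\<lambda>t. t i * exact_mean t i)" if "i < n" for i
      using sign_avg_split[OF that, of "\<lambda>t. t i * exact_mean t i"] by simp
    then show ?thesis by simp
  qed
  also have "\<dots> = sign_avg n (direct_contrast n exact_mean)"
    unfolding direct_contrast_def[abs_def] sign_avg_cmult sign_avg_sum
    by (simp add: sum_distrib_left[symmetric])
  finally show ?thesis .
qed

text \<open>
  \<open>F t = (1 - t i) * exact_mean t i - exact_mean (\<lambda>_. -1) i\<close> has \<open>F (t(i := 1))\<close> constant, and its
  average over the two values of \<open>t i\<close> is the summand of the indirect effect.
\<close>

lemma indirect_effect_eq: "indirect_effect n A \<mu> d \<tau> \<theta> P = sign_avg n (indirect_contrast n exact_mean)"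
proof -
  let ?m = exact_mean
  have "indirect_effect n A \<mu> d \<tau> \<theta> P = 1 / real n * (\<Sum>i<n. \<Sum>t\<in>sign_vectors ({..<n} - {i}).
      (1/2) ^ (n - 1) * (?m (t(i := -1)) i - ?m (\<lambda>_. -1) i))"
    unfolding indirect_effect_def exact_mean_def by (simp add: integrable_gibbs_mean)
  also have "\<dots> = 1 / real n * (\<Sum>i<n. sign_avg n (\<lambda>t. ?m t i) - sign_avg n (\<lambda>t. t i * ?m t i) - ?m (\<lambda>_. -1) i)"
  proof -
    have "(\<Sum>t\<in>sign_vectors ({..<n} - {i}). (1/2) ^ (n - 1) * (?m (t(i := -1)) i - ?m (\<lambda>_. -1) i))
        = sign_avg n (\<lambda>t. ?m t i) - sign_avg n (\<lambda>t. t i * ?m t i) - ?m (\<lambda>_. -1) i" if "i < n" for i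
    proof -
      \<comment> \<open>at \<open>t i = 1\<close> the first two terms cancel, at \<open>t i = -1\<close> they add up\<close>
      define F where "F = (\<lambda>t. ?m t i - t i * ?m t i - ?m (\<lambda>_. -1) i)"
      have "(1/2) ^ (n - 1) * (?m (t(i := -1)) i - ?m (\<lambda>_. -1) i)
          = 1/2 * ((1/2) ^ (n - 1) * (F (t(i := 1)) + F (t(i := -1))))" for t
        by (simp add: F_def)
      then have "(\<Sum>t\<in>sign_vectors ({..<n} - {i}). (1/2) ^ (n - 1) * (?m (t(i := -1)) i - ?m (\<lambda>_. -1) i))
          = 1/2 * (2 * sign_avg n F)"
        by (simp only: sum_distrib_left[symmetric] sign_avg_split[OF that, symmetric])
      then show ?thesis by (simp add: F_def sign_avg_diff)
    qed
    then show ?thesis by simp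
  qed
  also have "\<dots> = sign_avg n (indirect_contrast n ?m)"
    unfolding indirect_contrast_def[abs_def] direct_contrast_def[abs_def]
      sign_avg_diff sign_avg_cmult sign_avg_sum sign_avg_const
    by (simp add: sum_subtractf right_diff_distrib)
  finally show ?thesis .
qed

lemma mean_field_errors:
  assumes op: "op_norm A \<le> 1/8"
  defines "\<delta> M \<equiv> 3 * ((1/2) ^ M + 36 * sqrt (frob_sq n A / real n))"
  shows "\<bar>expect_TX n P (DE_hat n A \<mu> d \<tau> \<theta> M) - direct_effect n A \<mu> d \<tau> \<theta> P\<bar> \<le> \<delta> M"
    and "\<bar>expect_TX n P (IE_hat n A \<mu> d \<tau> \<theta> M) - indirect_effect n A \<mu> d \<tau> \<theta> P\<bar> \<le> \<delta> M"
proof -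
  define D where "D = real n * (1/2) ^ M + 36 * sqrt (real n * frob_sq n A)"
  have "sqrt (real n * frob_sq n A) = real n * sqrt (frob_sq n A / real n)"
    using n_pos by (simp add: real_sqrt_mult real_sqrt_divide field_simps)
  then have D: "3 / real n * D = \<delta> M"
    using n_pos by (simp add: D_def \<delta>_def field_simps)
  have D0: "0 \<le> D" by (simp add: D_def frob_sq_nonneg)
  have close: "(\<Sum>i<n. \<bar>mf_mean M t i - exact_mean t i\<bar>) \<le> D" for t
    unfolding D_def by (rule mf_mean_near_exact_mean[OF op])
  have "\<bar>expect_TX n P (DE_hat n A \<mu> d \<tau> \<theta> M) - direct_effect n A \<mu> d \<tau> \<theta> P\<bar> \<le> 2 / real n * D"
    unfolding expect_DE_hat direct_effect_eq
    by (intro sign_avg_diff_le direct_contrast_diff_le close)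
  also have "\<dots> \<le> 3 / real n * D" by (intro mult_right_mono divide_right_mono D0) auto
  finally show "\<bar>expect_TX n P (DE_hat n A \<mu> d \<tau> \<theta> M) - direct_effect n A \<mu> d \<tau> \<theta> P\<bar> \<le> \<delta> M"
    unfolding D .
  show "\<bar>expect_TX n P (IE_hat n A \<mu> d \<tau> \<theta> M) - indirect_effect n A \<mu> d \<tau> \<theta> P\<bar> \<le> \<delta> M"
    unfolding expect_IE_hat indirect_effect_eq D[symmetric]
    by (intro sign_avg_diff_le indirect_contrast_diff_le close)
qed

end

section \<open>The iterated limit\<close>

lemma limsup_error_tendsto_zero:
  fixes f :: "nat \<Rightarrow> nat \<Rightarrow> real"
  assumes s: "s \<longlonglongrightarrow> 0"
    and f: "\<And>M. eventually (\<lambda>n. \<bar>f M n\<bar> \<le> 3 * ((1/2) ^ M + 36 * sqrt (s n))) sequentially"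
  shows "(\<lambda>M. limsup (\<lambda>n. ereal \<bar>f M n\<bar>)) \<longlonglongrightarrow> 0"
proof (rule tendsto_sandwich)
  show "eventually (\<lambda>M. 0 \<le> limsup (\<lambda>n. ereal \<bar>f M n\<bar>)) sequentially"
    by (intro always_eventually allI le_Limsup) auto
  have "limsup (\<lambda>n. ereal \<bar>f M n\<bar>) \<le> ereal (3 * (1/2) ^ M)" for M
  proof -
    have "(\<lambda>n. 3 * ((1/2) ^ M + 36 * sqrt (s n))) \<longlonglongrightarrow> 3 * ((1/2) ^ M + 36 * sqrt 0)"
      by (intro tendsto_intros s)
    then have "(\<lambda>n. ereal (3 * ((1/2) ^ M + 36 * sqrt (s n)))) \<longlonglongrightarrow> ereal (3 * (1/2) ^ M)"
      by simp
    then have "limsup (\<lambda>n. ereal (3 * ((1/2) ^ M + 36 * sqrt (s n)))) = ereal (3 * (1/2) ^ M)"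
      by (intro lim_imp_Limsup) auto
    moreover have "limsup (\<lambda>n. ereal \<bar>f M n\<bar>) \<le> limsup (\<lambda>n. ereal (3 * ((1/2) ^ M + 36 * sqrt (s n))))"
      by (rule Limsup_mono) (use f[of M] in \<open>simp del: distrib_left_numeral\<close>)
    ultimately show ?thesis by simp
  qed
  then show "eventually (\<lambda>M. limsup (\<lambda>n. ereal \<bar>f M n\<bar>) \<le> ereal (3 * (1/2) ^ M)) sequentially"
    by simp
  have "(\<lambda>M. 3 * (1/2 :: real) ^ M) \<longlonglongrightarrow> 3 * 0" by (intro tendsto_intros LIMSEQ_realpow_zero) auto
  then show "(\<lambda>M. ereal (3 * (1/2) ^ M)) \<longlonglongrightarrow> 0" by (simp add: zero_ereal_def)
qed simp

theorem theorem2p1: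
  shows "\<exists>C\<^sub>0::real. C\<^sub>0 > 0 \<and>
    (\<forall>(\<mu>::real measure) (d::nat) (P::(nat \<Rightarrow> real) measure) (c::real) (C::real)
      (B::real) (M\<^sub>0::real) (\<tau>\<^sub>0::real) (\<theta>\<^sub>0::nat \<Rightarrow> real) (A::nat \<Rightarrow> real mat).
      prob_space \<mu> \<longrightarrow> sets \<mu> = sets borel \<longrightarrow>
      (AE y in \<mu>. y \<in> {-1..1}) \<longrightarrow>
      (\<exists>a\<in>measure_support \<mu>. \<exists>b\<in>measure_support \<mu>. a \<noteq> b) \<longrightarrow>
      d \<ge> 1 \<longrightarrow>
      prob_space P \<longrightarrow> sets P = sets (\<Pi>\<^sub>M k\<in>{..<d}. (borel :: real measure)) \<longrightarrow>
      (AE x in P. \<forall>k<d. x k \<in> {-1..1}) \<longrightarrow>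
      0 < c \<longrightarrow> c \<le> C \<longrightarrow>
      (\<forall>e. eigenvalue (covariance_mat d P) e \<longrightarrow> e \<in> {c..C}) \<longrightarrow>
      B > 0 \<longrightarrow> M\<^sub>0 > 0 \<longrightarrow> \<tau>\<^sub>0 \<in> {-B..B} \<longrightarrow> (\<forall>k<d. \<theta>\<^sub>0 k \<in> {-M\<^sub>0..M\<^sub>0}) \<longrightarrow>
      (\<forall>n\<ge>1. A n \<in> carrier_mat n n \<and> transpose_mat (A n) = A n) \<longrightarrow>
      bdd_above ((\<lambda>n. op_norm (A n)) ` {1..}) \<longrightarrow>
      (\<lambda>n. mat_trace (A n ^\<^sub>m 2)) \<in> o(\<lambda>n. real n) \<longrightarrow>
      limsup (\<lambda>n. ereal (op_norm (A n))) \<le> ereal C\<^sub>0 \<longrightarrow>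
      (\<lambda>M. limsup (\<lambda>n. ereal \<bar>expect_TX n P (DE_hat n (A n) \<mu> d \<tau>\<^sub>0 \<theta>\<^sub>0 M)
                              - direct_effect n (A n) \<mu> d \<tau>\<^sub>0 \<theta>\<^sub>0 P\<bar>)) \<longlonglongrightarrow> 0 \<and>
      (\<lambda>M. limsup (\<lambda>n. ereal \<bar>expect_TX n P (IE_hat n (A n) \<mu> d \<tau>\<^sub>0 \<theta>\<^sub>0 M)
                              - indirect_effect n (A n) \<mu> d \<tau>\<^sub>0 \<theta>\<^sub>0 P\<bar>)) \<longlonglongrightarrow> 0)"
proof (intro exI[of _ "1/16"] conjI allI impI)
  show "(0::real) < 1/16" by simp
next
  fix \<mu> :: "real measure" and d :: nat and P :: "(nat \<Rightarrow> real) measure" and c C B M\<^sub>0 \<tau>\<^sub>0 :: real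
    and \<theta>\<^sub>0 :: "nat \<Rightarrow> real" and A :: "nat \<Rightarrow> real mat"
  assume mu: "prob_space \<mu>" "sets \<mu> = sets borel" "AE y in \<mu>. y \<in> {-1..1}"
    and P: "prob_space P" "sets P = sets (\<Pi>\<^sub>M k\<in>{..<d}. (borel :: real measure))"
    and A: "\<forall>n\<ge>1. A n \<in> carrier_mat n n \<and> transpose_mat (A n) = A n"
    and trace: "(\<lambda>n. mat_trace (A n ^\<^sub>m 2)) \<in> o(\<lambda>n. real n)"
    and op: "limsup (\<lambda>n. ereal (op_norm (A n))) \<le> ereal (1/16)"
  define s where "s = (\<lambda>n. frob_sq n (A n) / real n)"
  have "(\<lambda>n. mat_trace (A n ^\<^sub>m 2) / real n) \<longlonglongrightarrow> 0"
    using trace by (rule smalloD_tendsto)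
  moreover have "eventually (\<lambda>n. mat_trace (A n ^\<^sub>m 2) / real n = s n) sequentially"
    using eventually_ge_at_top[of 1] by eventually_elim (use A mat_trace_square in \<open>simp add: s_def\<close>)
  ultimately have s: "s \<longlonglongrightarrow> 0" by (rule Lim_transform_eventually)
  have "limsup (\<lambda>n. ereal (op_norm (A n))) < ereal (1/8)"
    by (rule order_le_less_trans[OF op]) simp
  from Limsup_lessD[OF this] have "eventually (\<lambda>n. op_norm (A n) \<le> 1/8) sequentially"
    by eventually_elim simp
  then have good: "eventually (\<lambda>n. effect_model \<mu> n (A n) P d \<and> op_norm (A n) \<le> 1/8) sequentially"
    using eventually_ge_at_top[of 1]
  proof eventually_elim
    case (elim n)
    have "bounded_spin \<mu>" using mu by (simp add: bounded_spin_def bounded_spin_axioms_def)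
    then have "effect_model \<mu> n (A n) P d"
      using elim A P by (simp add: effect_model_def effect_model_axioms_def)
    then show ?case using elim by simp
  qed
  have DE: "eventually (\<lambda>n. \<bar>expect_TX n P (DE_hat n (A n) \<mu> d \<tau>\<^sub>0 \<theta>\<^sub>0 M) - direct_effect n (A n) \<mu> d \<tau>\<^sub>0 \<theta>\<^sub>0 P\<bar>
      \<le> 3 * ((1/2) ^ M + 36 * sqrt (s n))) sequentially" for M
    using good unfolding s_def by eventually_elim (intro effect_model.mean_field_errors(1); simp)
  have IE: "eventually (\<lambda>n. \<bar>expect_TX n P (IE_hat n (A n) \<mu> d \<tau>\<^sub>0 \<theta>\<^sub>0 M) - indirect_effect n (A n) \<mu> d \<tau>\<^sub>0 \<theta>\<^sub>0 P\<bar>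
      \<le> 3 * ((1/2) ^ M + 36 * sqrt (s n))) sequentially" for M
    using good unfolding s_def by eventually_elim (intro effect_model.mean_field_errors(2); simp)
  show "(\<lambda>M. limsup (\<lambda>n. ereal \<bar>expect_TX n P (DE_hat n (A n) \<mu> d \<tau>\<^sub>0 \<theta>\<^sub>0 M)
                              - direct_effect n (A n) \<mu> d \<tau>\<^sub>0 \<theta>\<^sub>0 P\<bar>)) \<longlonglongrightarrow> 0"
    by (rule limsup_error_tendsto_zero[OF s DE])
  show "(\<lambda>M. limsup (\<lambda>n. ereal \<bar>expect_TX n P (IE_hat n (A n) \<mu> d \<tau>\<^sub>0 \<theta>\<^sub>0 M)
                              - indirect_effect n (A n) \<mu> d \<tau>\<^sub>0 \<theta>\<^sub>0 P\<bar>)) \<longlonglongrightarrow> 0"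
    by (rule limsup_error_tendsto_zero[OF s IE])
qed

end
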